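(* Let $n\ge2$, $I=[l,u]$, let $G:I\times\mathbb R^n\to\mathbb R$ and let $\rho$ be an integrable probability density on $\mathbb R^n$ with $\mathbb E N(G,\rho,I)<+\infty$. Write $H((t_1,t_2),x)=\{G(t_1,x),G'(t_2,x)\}$ (the pair, viewed as an $\mathbb R^2$-valued function), $V((t_1,t_2),x)=\|\nabla G(t_1,x)\|^2\|\nabla G'(t_2,x)\|^2-(\nabla G(t_1,x)^\top\nabla G'(t_2,x))^2$, $Q_1((t_1,t_2),x)=G'(t_1,x)G''(t_2,x)V((t_1,t_2),x)$, $Q_2(t,x)=G'(t,x)\|\nabla G(t,x)\|$, $$T(\hat t)=\int_{L(G(t,x),\{\hat t\})}\rho(x)\frac{|G'(\hat t,x)|}{\|\nabla G(\hat t,x)\|}\,d\mathbb H^{n-1},\qquad K(\hat t_1,\hat t_2)=\int_{L(H((t_1,t_2),x),\{(\hat t_1,\hat t_2)\})}\rho(x)\frac{|G'(\hat t_1,x)||G''(\hat t_2,x)|}{\sqrt{V((\hat t_1,\hat t_2),x)}}\,d\mathbb H^{n-2}.$$ Suppose that (A), given $t^*\in[l,u)\setminus\Psi_{G,\rho}(I)$, there exists $\bar\varepsilon\in(0,u-t^*]$, depending on $t^*$, such that for every $\varepsilon\in(0,\bar\varepsilon)$: (A1) $G'(t,x),G''(t,x),\nabla G(t,x),\nabla G'(t,x)$ exist and are continuous on $[t^*,t^*+\varepsilon]\times L(H((t_1,t_2),x),[t^*,t^*+\varepsilon]^2)$; (A2) $\int_{L(G(t,x),\{t^*\})}\rho(x)\,dx=0$;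 (A3) there exists a nonnegative, $(t^*,\varepsilon)$-parameterized, Lebesgue integrable function $C_{t^*,\varepsilon}(t_1,t_2)$ on $[t^*,t^*+\varepsilon]^2$ such that $K(\hat t_1,\hat t_2)\le C_{t^*,\varepsilon}(\hat t_1,\hat t_2)$ for almost every $(\hat t_1,\hat t_2)\in[t^*,t^*+\varepsilon]^2$, and $\int_{[t^*,t^*+\varepsilon]}d\hat t_1\int_{[t^*,t^*+\varepsilon]}C_{t^*,\varepsilon}(\hat t_1,\hat t_2)\,d\hat t_2=o(\varepsilon)$; (A4) $\int_{\Xi(H((t_1,t_2),x),Q_1((t_1,t_2),x),[t^*,t^*+\varepsilon]^2)}\rho(x)\,dx=0$. Suppose in addition: (1) $G'(t,x),G''(t,x),\nabla G(t,x),\nabla G'(t,x)$ exist and are continuous on $I\times L(H((t_1,t_2),x),I^2)$; (2) $T(\hat t)$ is Lebesgue integrable on $I$; (3) for every $\hat t\in I$, there exists $\varepsilon>0$ and an $(\hat t,\varepsilon)$-parameterized Lebesgue integrable function $C_{\hat t,\varepsilon}(\hat t_1,\hat t_2)$ defined on $[\hat t,\hat t+\varepsilon]^2$ such that for almost every $(\hat t_1,\hat t_2)\in[\hat t,\hat t+\varepsilon]^2$, $K(\hat t_1,\hat t_2)\le C_{\hat t,\varepsilon}(\hat t_1,\hat t_2)$, and $\int_{[\hat t,\hat t+\varepsilon]}d\hat t_1\int_{[\hat t,\hat t+\varepsilon]}C_{\hat t,\varepsilon}(\hat t_1,\hat t_2)\,d\hat t_2=o(\varepsilon)$; (4) for every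 closed subinterval $\bar I=[a,b]\subseteq I$ with $a\ne b$, $\int_{\Xi(G(t,x),Q_2(t,x),\bar I)}\rho(x)\,dx=0$; (5) for almost every $\hat t\in I$, there exists $\varepsilon>0$ such that $\int_{\Xi(H((t_1,t_2),x),Q_1((t_1,t_2),x),[\hat t,\hat t+\varepsilon]^2)}\rho(x)\,dx=0$. Then $$\mathbb E N(G,\rho,I)=\int_I\eta(t)\,dt,\qquad \eta(t)=\Big(\int_{\Theta(t,\varepsilon)}\rho(x)\,dx\Big)'\Big|_{\varepsilon=0},$$ where $\Theta(t,\varepsilon)=\{x\in\mathbb R^n\mid G(t,x)G(t+\varepsilon,x)\le0\}$ and the prime in the definition of $\eta(t)$ denotes the derivative in $\varepsilon$ (with $\varepsilon\to0_+$).
   Context: For $J\subseteq I$, $N(x,G,J)=\#\{t\in J\mid G(t,x)=0\}$, $\mathbb E N(G,\rho,J)=\int_{\mathbb R^n}N(x,G,J)\rho(x)\,dx$, and $\Lambda_i(G,J)=\{x\in\mathbb R^n\mid N(x,G,J)\ge i\}$ for $i\in\mathbb N=\{1,2,\dots\}$. $\varphi_{G,\rho}(t)=\mathbb E N(G,\rho,[l,t])$, $t\in[l,u]$. $\Psi_{G,\rho}(I)$ is the (Lebesgue null) set of $t\in I$ at which the equality $\varphi_{G,\rho}'(t)=\sum_{i=1}^\infty\big(\int_{\Lambda_i(G,[l,t])}\rho(x)\,dx\big)'$ (derivatives in $t$) fails. Notation: primes on $G$ denote derivatives in $t$; $\nabla$ is the gradient in $x$; $\|\cdot\|$ is the Euclidean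 norm; $\mathbb H^m$ is $m$-dimensional Hausdorff measure. For $J\subseteq A\subseteq\mathbb R^k$ and (scalar or vector valued) functions $P(s,x)$, $Q(s,x)$ on $A\times\mathbb R^n$: $L(P(s,x),J)=\bigcup_{s\in J}\{x\in\mathbb R^n\mid P(s,x)=0\}$; $\eta(P(s,x),J,x)=\{s\in J\mid P(s,x)=0\}$; $\Xi(P(s,x),Q(s,x),J)=\{x\in\mathbb R^n\mid \emptyset\ne\eta(P(s,x),J,x)\subseteq\eta(Q(s,x),J,x)\}$ (this three-argument $\eta$ is unrelated to $\eta(t)$). *)

theory Defs
  imports "HOL-Analysis.Analysis" "HOL-Library.Landau_Symbols"
begin

text \<open>
  Hausdorff measure, normalised so that in \<open>\<real>\<^sup>n\<close> the \<open>n\<close>-dimensional one is Lebesgue measure.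
  The case distinction on the empty set matters only for \<open>m = 0\<close>, where \<open>0 ^ 0 = 1\<close> makes
  every nonempty set of diameter \<open>0\<close> count once, so that \<open>\<H>\<^sup>0\<close> is counting measure.
  Boundedness is required because \<^const>\<open>diameter\<close> is unspecified on unbounded sets.
\<close>

definition hausdorff_gauge :: "nat \<Rightarrow> 'a::metric_space set \<Rightarrow> ennreal" where
  "hausdorff_gauge m S =
     (if S = {} then 0 else ennreal (unit_ball_vol (real m) * (diameter S / 2) ^ m))"

definition hausdorff_pre :: "real \<Rightarrow> nat \<Rightarrow> 'a::metric_space set \<Rightarrow> ennreal" where
  "hausdorff_pre \<delta> m A =
     (INF S \<in> {S :: nat \<Rightarrow> 'a set. A \<subseteq> (\<Union>i. S i) \<and> (\<forall>i. bounded (S i) \<and> diameter (S i) \<le> \<delta>)}.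
        \<Sum>i. hausdorff_gauge m (S i))"

definition hausdorff_outer :: "nat \<Rightarrow> 'a::metric_space set \<Rightarrow> ennreal" where
  "hausdorff_outer m A = (SUP \<delta> \<in> {0<..}. hausdorff_pre \<delta> m A)"

definition hausdorff_measure :: "nat \<Rightarrow> 'a::metric_space measure" where
  "hausdorff_measure m =
     measure_of UNIV (lambda_system UNIV (Pow UNIV) (hausdorff_outer m)) (hausdorff_outer m)"

lemma hausdorff_pre_empty:
  assumes "\<delta> > 0" shows "hausdorff_pre \<delta> m ({} :: 'a::metric_space set) = 0"
proof -
  have "hausdorff_pre \<delta> m ({} :: 'a set) \<le> (\<Sum>i::nat. hausdorff_gauge m ({} :: 'a set))"
    unfolding hausdorff_pre_def using assms
    by (intro INF_lower2[of "\<lambda>_. {}"]) auto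
  then show ?thesis by (simp add: hausdorff_gauge_def)
qed

lemma hausdorff_pre_mono: "A \<subseteq> B \<Longrightarrow> hausdorff_pre \<delta> m A \<le> hausdorff_pre \<delta> m B"
  unfolding hausdorff_pre_def by (intro INF_superset_mono) auto

lemma hausdorff_pre_Union:
  fixes A :: "nat \<Rightarrow> 'a::metric_space set"
  shows "hausdorff_pre \<delta> m (\<Union>i. A i) \<le> (\<Sum>i. hausdorff_pre \<delta> m (A i))"
proof (rule ennreal_le_epsilon)
  fix e :: real assume fin: "(\<Sum>i. hausdorff_pre \<delta> m (A i)) < top" and e: "0 < e"
  have "\<exists>S :: nat \<Rightarrow> 'a set. A i \<subseteq> (\<Union>j. S j) \<and> (\<forall>j. bounded (S j) \<and> diameter (S j) \<le> \<delta>) \<and>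
          (\<Sum>j. hausdorff_gauge m (S j)) \<le> hausdorff_pre \<delta> m (A i) + ennreal (e * (1/2) ^ Suc i)" for i
  proof -
    have "hausdorff_pre \<delta> m (A i) < top"
      using fin by (metis ennreal_suminf_lessD)
    then have "hausdorff_pre \<delta> m (A i) < hausdorff_pre \<delta> m (A i) + ennreal (e * (1/2) ^ Suc i)"
      using e by (simp add: ennreal_add_left_cancel_less[of _ 0, simplified])
    then show ?thesis
      unfolding hausdorff_pre_def INF_less_iff by (auto intro: less_imp_le)
  qed
  then obtain S :: "nat \<Rightarrow> nat \<Rightarrow> 'a set" where
    S: "\<And>i. A i \<subseteq> (\<Union>j. S i j)" "\<And>i j. bounded (S i j)" "\<And>i j. diameter (S i j) \<le> \<delta>"
      "\<And>i. (\<Sum>j. hausdorff_gauge m (S i j)) \<le> hausdorff_pre \<delta> m (A i) + ennreal (e * (1/2) ^ Suc i)"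
    by metis
  define R where "R k = (case prod_decode k of (i, j) \<Rightarrow> S i j)" for k
  have "(\<Union>i. A i) \<subseteq> (\<Union>k. R k)"
  proof
    fix x assume "x \<in> (\<Union>i. A i)"
    then obtain i where "x \<in> A i" by blast
    then obtain j where "x \<in> S i j" using S(1) by blast
    then have "x \<in> R (prod_encode (i, j))" by (simp add: R_def)
    then show "x \<in> (\<Union>k. R k)" by blast
  qed
  then have "hausdorff_pre \<delta> m (\<Union>i. A i) \<le> (\<Sum>k. hausdorff_gauge m (R k))"
    unfolding hausdorff_pre_def using S
    by (intro INF_lower) (auto simp: R_def split: prod.splits)
  also have "\<dots> = (\<Sum>k. (\<lambda>(i, j). hausdorff_gauge m (S i j)) (prod_decode k))"
    by (intro suminf_cong) (auto simp: R_def split: prod.splits)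
  also have "\<dots> = (\<Sum>i. \<Sum>j. hausdorff_gauge m (S i j))"
    by (rule suminf_ennreal_2dimen[where f = "\<lambda>(i, j). hausdorff_gauge m (S i j)", unfolded o_def]) simp
  also have "\<dots> \<le> (\<Sum>i. hausdorff_pre \<delta> m (A i) + ennreal (e * (1/2) ^ Suc i))"
    by (intro suminf_le S) auto
  also have "\<dots> = (\<Sum>i. hausdorff_pre \<delta> m (A i)) + (\<Sum>i. ennreal (e * (1/2) ^ Suc i))"
    by (intro suminf_add[symmetric]) auto
  also have "(\<Sum>i. ennreal (e * (1/2) ^ Suc i)) = ennreal e"
    using e sums_mult[OF power_half_series, of e]
    by (intro suminf_ennreal_eq) auto
  finally show "hausdorff_pre \<delta> m (\<Union>i. A i) \<le> (\<Sum>i. hausdorff_pre \<delta> m (A i)) + ennreal e" .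
qed

lemma outer_measure_space_hausdorff_outer:
  "outer_measure_space (Pow UNIV) (hausdorff_outer m :: 'a::metric_space set \<Rightarrow> ennreal)"
proof -
  have "hausdorff_outer m (\<Union>i. A i) \<le> (\<Sum>i. hausdorff_outer m (A i))" for A :: "nat \<Rightarrow> 'a set"
    unfolding hausdorff_outer_def
  proof (rule SUP_least)
    fix \<delta> :: real assume d: "\<delta> \<in> {0<..}"
    have "hausdorff_pre \<delta> m (\<Union>i. A i) \<le> (\<Sum>i. hausdorff_pre \<delta> m (A i))"
      by (rule hausdorff_pre_Union)
    also have "\<dots> \<le> (\<Sum>i. SUP \<delta> \<in> {0<..}. hausdorff_pre \<delta> m (A i))"
      using d by (intro suminf_le SUP_upper) auto
    finally show "hausdorff_pre \<delta> m (\<Union>i. A i) \<le> (\<Sum>i. SUP \<delta> \<in> {0<..}. hausdorff_pre \<delta> m (A i))" .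
  qed
  moreover have "hausdorff_outer m ({} :: 'a set) = 0"
    unfolding hausdorff_outer_def by (simp add: hausdorff_pre_empty)
  moreover have "hausdorff_outer m A \<le> hausdorff_outer m B" if "A \<subseteq> B" for A B :: "'a set"
    unfolding hausdorff_outer_def using that by (intro SUP_mono) (auto intro: hausdorff_pre_mono)
  ultimately show ?thesis
    by (auto simp: outer_measure_space_def positive_def increasing_def countably_subadditive_def)
qed

lemma
  shows space_hausdorff_measure: "space (hausdorff_measure m :: 'a::metric_space measure) = UNIV"
    and sets_hausdorff_measure: "sets (hausdorff_measure m :: 'a measure) =
      lambda_system UNIV (Pow UNIV) (hausdorff_outer m)"
    and emeasure_hausdorff_measure:
      "A \<in> sets (hausdorff_measure m :: 'a measure) \<Longrightarrow>
        emeasure (hausdorff_measure m) A = hausdorff_outer m A"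
proof -
  let ?L = "lambda_system UNIV (Pow UNIV) (hausdorff_outer m :: 'a set \<Rightarrow> ennreal)"
  interpret P: sigma_algebra "UNIV :: 'a set" "Pow UNIV" by (rule sigma_algebra_Pow)
  have ms: "measure_space UNIV ?L (hausdorff_outer m)"
    by (rule P.caratheodory_lemma) (rule outer_measure_space_hausdorff_outer)
  then have sa: "sigma_algebra UNIV ?L" by (simp add: measure_space_def)
  show "space (hausdorff_measure m :: 'a measure) = UNIV"
    by (simp add: hausdorff_measure_def)
  show s: "sets (hausdorff_measure m :: 'a measure) = ?L"
    unfolding hausdorff_measure_def
    by (subst sets_measure_of) (auto simp del: Pow_UNIV simp: sigma_algebra.sigma_sets_eq[OF sa])
  show "emeasure (hausdorff_measure m) A = hausdorff_outer m A"
    if "A \<in> sets (hausdorff_measure m :: 'a measure)"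
    using that ms sa unfolding s unfolding hausdorff_measure_def
    by (intro emeasure_measure_of_sigma) (auto simp: measure_space_def)
qed


definition zero_count :: "(real \<Rightarrow> 'a \<Rightarrow> real) \<Rightarrow> real set \<Rightarrow> 'a \<Rightarrow> ennreal" where
  "zero_count G J x = emeasure (count_space UNIV) {t \<in> J. G t x = 0}"

definition expected_zeros ::
    "(real \<Rightarrow> 'a::euclidean_space \<Rightarrow> real) \<Rightarrow> ('a \<Rightarrow> real) \<Rightarrow> real set \<Rightarrow> ennreal" where
  "expected_zeros G \<rho> J = (\<integral>\<^sup>+x. zero_count G J x * ennreal (\<rho> x) \<partial>lebesgue)"

definition Lambda :: "(real \<Rightarrow> 'a \<Rightarrow> real) \<Rightarrow> nat \<Rightarrow> real set \<Rightarrow> 'a set" where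
  "Lambda G i J = {x. zero_count G J x \<ge> of_nat i}"

text \<open>
  The exceptional set: the termwise differentiation formula holds at \<open>t\<close> only if all the
  derivatives (one-sided at the endpoints) exist and the series over \<open>i \<ge> 1\<close> converges.
\<close>

definition Psi ::
    "real \<Rightarrow> real \<Rightarrow> (real \<Rightarrow> 'a::euclidean_space \<Rightarrow> real) \<Rightarrow> ('a \<Rightarrow> real) \<Rightarrow> real set" where
  "Psi l u G \<rho> = {t \<in> {l..u}. \<not> (\<exists>d D.
     ((\<lambda>s. enn2real (expected_zeros G \<rho> {l..s})) has_real_derivative d) (at t within {l..u}) \<and>
     (\<forall>i\<ge>1. ((\<lambda>s. LINT x:Lambda G i {l..s}|lebesgue. \<rho> x) has_real_derivative D i)
               (at t within {l..u})) \<and>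
     (\<lambda>i. D (Suc i)) sums d)}"


definition zero_locus :: "('s \<Rightarrow> 'a \<Rightarrow> 'v::zero) \<Rightarrow> 's set \<Rightarrow> 'a set" where
  "zero_locus P J = (\<Union>s\<in>J. {x. P s x = 0})"

definition zero_params :: "('s \<Rightarrow> 'a \<Rightarrow> 'v::zero) \<Rightarrow> 's set \<Rightarrow> 'a \<Rightarrow> 's set" where
  "zero_params P J x = {s \<in> J. P s x = 0}"

definition Xi :: "('s \<Rightarrow> 'a \<Rightarrow> 'v::zero) \<Rightarrow> ('s \<Rightarrow> 'a \<Rightarrow> 'w::zero) \<Rightarrow> 's set \<Rightarrow> 'a set" where
  "Xi P Q J = {x. {} \<noteq> zero_params P J x \<and> zero_params P J x \<subseteq> zero_params Q J x}"


text \<open>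
  \<open>G\<close> lives on \<open>I \<times> \<real>\<^sup>n\<close>, so derivatives in \<open>t\<close> are taken within \<open>I\<close>
  (one-sided at its endpoints) and values of \<open>G\<close> at \<open>t \<notin> I\<close> play no role.
\<close>

definition tderiv :: "real set \<Rightarrow> (real \<Rightarrow> 'a \<Rightarrow> real) \<Rightarrow> real \<Rightarrow> 'a \<Rightarrow> real" where
  "tderiv I G t x = vector_derivative (\<lambda>s. G s x) (at t within I)"

definition grad :: "('a::real_inner \<Rightarrow> real) \<Rightarrow> 'a \<Rightarrow> 'a" where
  "grad f x = (THE D. GDERIV f x :> D)"

definition pairH :: "real set \<Rightarrow> (real \<Rightarrow> 'a \<Rightarrow> real) \<Rightarrow> real \<times> real \<Rightarrow> 'a \<Rightarrow> real \<times> real" where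
  "pairH I G = (\<lambda>(t1, t2) x. (G t1 x, tderiv I G t2 x))"

definition gramV :: "real set \<Rightarrow> (real \<Rightarrow> 'a::real_inner \<Rightarrow> real) \<Rightarrow> real \<times> real \<Rightarrow> 'a \<Rightarrow> real" where
  "gramV I G = (\<lambda>(t1, t2) x.
     (norm (grad (G t1) x))\<^sup>2 * (norm (grad (tderiv I G t2) x))\<^sup>2
       - (grad (G t1) x \<bullet> grad (tderiv I G t2) x)\<^sup>2)"

definition Q1 :: "real set \<Rightarrow> (real \<Rightarrow> 'a::real_inner \<Rightarrow> real) \<Rightarrow> real \<times> real \<Rightarrow> 'a \<Rightarrow> real" where
  "Q1 I G = (\<lambda>(t1, t2) x. tderiv I G t1 x * tderiv I (tderiv I G) t2 x * gramV I G (t1, t2) x)"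

definition Q2 :: "real set \<Rightarrow> (real \<Rightarrow> 'a::real_inner \<Rightarrow> real) \<Rightarrow> real \<Rightarrow> 'a \<Rightarrow> real" where
  "Q2 I G t x = tderiv I G t x * norm (grad (G t) x)"

text \<open>
  The surface integrals may be infinite. The quotients are formed in \<^typ>\<open>ennreal\<close>, so a vanishing
  denominator under a positive numerator gives \<open>\<infinity>\<close> and not \<open>0\<close>.
\<close>

definition surfT :: "real set \<Rightarrow> (real \<Rightarrow> real^'n \<Rightarrow> real) \<Rightarrow> (real^'n \<Rightarrow> real) \<Rightarrow> real \<Rightarrow> ennreal" where
  "surfT I G \<rho> t =
     (\<integral>\<^sup>+x \<in> zero_locus G {t}.
        ennreal (\<rho> x * \<bar>tderiv I G t x\<bar>) / ennreal (norm (grad (G t) x))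
      \<partial>hausdorff_measure (CARD('n) - 1))"

definition surfK ::
    "real set \<Rightarrow> (real \<Rightarrow> real^'n \<Rightarrow> real) \<Rightarrow> (real^'n \<Rightarrow> real) \<Rightarrow> real \<times> real \<Rightarrow> ennreal" where
  "surfK I G \<rho> = (\<lambda>(t1, t2).
     (\<integral>\<^sup>+x \<in> zero_locus (pairH I G) {(t1, t2)}.
        ennreal (\<rho> x * \<bar>tderiv I G t1 x\<bar> * \<bar>tderiv I (tderiv I G) t2 x\<bar>)
          / ennreal (sqrt (gramV I G (t1, t2) x))
      \<partial>hausdorff_measure (CARD('n) - 2)))"

definition derivs_exist_continuous ::
    "real set \<Rightarrow> (real \<Rightarrow> 'a::real_inner \<Rightarrow> real) \<Rightarrow> real set \<Rightarrow> 'a set \<Rightarrow> bool" where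
  "derivs_exist_continuous I G J X \<longleftrightarrow>
     (\<forall>t\<in>J. \<forall>x\<in>X.
        (\<lambda>s. G s x) differentiable (at t within I) \<and>
        (\<lambda>s. tderiv I G s x) differentiable (at t within I) \<and>
        (\<exists>D. GDERIV (G t) x :> D) \<and>
        (\<exists>D. GDERIV (tderiv I G t) x :> D)) \<and>
     continuous_on (J \<times> X) (\<lambda>(t, x). tderiv I G t x) \<and>
     continuous_on (J \<times> X) (\<lambda>(t, x). tderiv I (tderiv I G) t x) \<and>
     continuous_on (J \<times> X) (\<lambda>(t, x). grad (G t) x) \<and>
     continuous_on (J \<times> X) (\<lambda>(t, x). grad (tderiv I G t) x)"

text \<open>
  The integral of \<open>\<rho>\<close> over \<open>S\<close> exists and is \<open>0\<close>; the value of a non-existing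
  Bochner integral would be \<open>0\<close> as well.
\<close>

definition null_integral :: "('a::euclidean_space \<Rightarrow> real) \<Rightarrow> 'a set \<Rightarrow> bool" where
  "null_integral \<rho> S \<longleftrightarrow> set_integrable lebesgue S \<rho> \<and> (LINT x:S|lebesgue. \<rho> x) = 0"

text \<open>
  The pointwise bound is stated in \<^typ>\<open>ereal\<close>: coercing \<open>C\<close> to \<^typ>\<open>ennreal\<close>
  would silently replace negative values by \<open>0\<close>.
\<close>

definition dominates_surfK ::
    "real set \<Rightarrow> (real \<Rightarrow> real^'n \<Rightarrow> real) \<Rightarrow> (real^'n \<Rightarrow> real) \<Rightarrow> real set
       \<Rightarrow> (real \<times> real \<Rightarrow> real) \<Rightarrow> bool" where
  "dominates_surfK I G \<rho> J C \<longleftrightarrow>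
     set_integrable lebesgue (J \<times> J) C \<and>
     (AE p in lebesgue_on (J \<times> J). enn2ereal (surfK I G \<rho> p) \<le> ereal (C p))"

definition iterated_integral :: "real set \<Rightarrow> (real \<times> real \<Rightarrow> real) \<Rightarrow> real" where
  "iterated_integral J C = (LINT t1:J|lebesgue. (LINT t2:J|lebesgue. C (t1, t2)))"

definition Theta :: "(real \<Rightarrow> 'a \<Rightarrow> real) \<Rightarrow> real \<Rightarrow> real \<Rightarrow> 'a set" where
  "Theta G t \<epsilon> = {x. G t x * G (t + \<epsilon>) x \<le> 0}"

definition Theta_mass ::
    "(real \<Rightarrow> 'a::euclidean_space \<Rightarrow> real) \<Rightarrow> ('a \<Rightarrow> real) \<Rightarrow> real \<Rightarrow> real \<Rightarrow> real" where
  "Theta_mass G \<rho> t \<epsilon> = (LINT x:Theta G t \<epsilon>|lebesgue. \<rho> x)"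

text \<open>The right derivative at \<open>\<epsilon> = 0\<close>; \<open>G t\<close> is only meaningful up to the right endpoint \<open>u\<close>.\<close>

definition zero_density ::
    "real \<Rightarrow> (real \<Rightarrow> 'a::euclidean_space \<Rightarrow> real) \<Rightarrow> ('a \<Rightarrow> real) \<Rightarrow> real \<Rightarrow> real" where
  "zero_density u G \<rho> t = vector_derivative (Theta_mass G \<rho> t) (at 0 within {0..u - t})"

end

(*
  The hypothesis on Xi(G, Q_2, [a,b]), applied to rational intervals isolating the zeros, shows that
  almost every x with rho(x) > 0 has finitely many zeros, all with G' and grad G nonzero. For such x
  and a Lebesgue null set N of times, no zero lies in N, up to a null set of x: on small pieces of
  the zero set one can exchange a coordinate of x for t by a map whose inverse is Lipschitz. Hence
  the intensity measure of the zeros has a density f, and its integral over I is the expected number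
  of zeros.

  Let the points x having two zeros in a common interval of a grid of mesh 1/k carry the intensity
  b_k. The b_k have integrals tending to 0, so their infimum vanishes almost everywhere; by Lebesgue
  differentiation, for almost every t both the expected number of zeros in [t, t+h] and the
  probability of exactly one zero there are f(t) h + o(h). The mass of Theta(t, h) lies between the
  two, because all zeros are sign changes.
*)

theory Submission
  imports Defs
begin

subsection \<open>Zeros at a null set of times\<close>

text \<open>Lebesgue measure is the product of one-dimensional ones. A Borel null superset of
  \<open>N\<close> turns the preimage into a measurable box with one null side.\<close>

lemma negligible_coordinate_preimage:
  fixes i :: "'a::euclidean_space"
  assumes N: "negligible N" and i: "i \<in> Basis"
  shows "negligible {z :: 'a. z \<bullet> i \<in> N}"
proof -
  interpret product_sigma_finite "\<lambda>_::'a. lborel :: real measure" ..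
  obtain N' where N': "N \<subseteq> N'" "N' \<in> null_sets lborel"
    using N by (auto simp: negligible_iff_null_sets elim: completionE null_sets_completion_iff2[THEN iffD1, THEN bexE])
  have [measurable]: "N' \<in> sets borel" using N'(2) by auto
  have *: "{f \<in> space (\<Pi>\<^sub>M b\<in>Basis. lborel). (\<Sum>b\<in>Basis. f b *\<^sub>R b) \<bullet> i \<in> N'} =
      Pi\<^sub>E Basis (\<lambda>j. if j = i then N' else UNIV)" (is "?L = _")
    using i by (auto simp: space_PiM PiE_iff inner_sum_left inner_Basis if_distrib extensional_def cong: if_cong)
  have "emeasure lborel {z :: 'a. z \<bullet> i \<in> N'} = emeasure (\<Pi>\<^sub>M b\<in>Basis. lborel) ?L"
    unfolding lborel_eq[where 'a='a]
    by (subst emeasure_distr) (auto intro!: arg_cong2[where f=emeasure])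
  also have "\<dots> = (\<Prod>j\<in>Basis. emeasure lborel (if j = i then N' else UNIV))"
    unfolding * by (subst emeasure_PiM) auto
  also have "\<dots> = 0"
    using i N'(2) by (intro prod_zero) (auto intro!: bexI[of _ i])
  finally have "{z :: 'a. z \<bullet> i \<in> N'} \<in> null_sets lborel" by auto
  then have "negligible {z :: 'a. z \<bullet> i \<in> N'}"
    by (simp add: negligible_iff_null_sets null_sets_completionI)
  then show ?thesis by (rule negligible_subset) (use N' in auto)
qed

text \<open>The linear part moves \<open>f\<close> by \<open>D \<bullet> i\<close> per unit along
  \<open>i\<close>. An error of half that rate can be absorbed, so the displacement along
  \<open>i\<close> is controlled by the value of \<open>f\<close> and the transverse
  displacement.\<close>

lemma GDERIV_coordinate_bound:
  fixes f :: "'a::euclidean_space \<Rightarrow> real"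
  assumes f: "GDERIV f x :> D" "f x = 0" and i: "i \<in> Basis" "D \<bullet> i \<noteq> 0"
  shows "\<exists>K d. K > 0 \<and> d > 0 \<and> (\<forall>y. norm (y - x) < d \<longrightarrow>
    \<bar>(y - x) \<bullet> i\<bar> \<le> K * (\<bar>f y\<bar> + norm ((y - x) - ((y - x) \<bullet> i) *\<^sub>R i)))"
proof -
  define e where "e = \<bar>D \<bullet> i\<bar> / 2"
  have e: "e > 0" using i by (simp add: e_def)
  obtain d where d: "d > 0" "\<And>y. norm (y - x) < d \<Longrightarrow> norm (f y - f x - (y - x) \<bullet> D) \<le> e * norm (y - x)"
    using f(1) e unfolding gderiv_def has_derivative_at_alt by blast
  define K where "K = (1 + norm D + e) / e"
  show ?thesis
  proof (intro exI conjI allI impI)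
    show "K > 0" using e by (simp add: K_def add_pos_nonneg)
    fix y assume y: "norm (y - x) < d"
    define a where "a = (y - x) \<bullet> i"
    define w where "w = (y - x) - a *\<^sub>R i"
    have yx: "y - x = a *\<^sub>R i + w" by (simp add: w_def)
    have n: "norm (y - x) \<le> \<bar>a\<bar> + norm w"
      unfolding yx using norm_triangle_ineq[of "a *\<^sub>R i" w] i by simp
    have in1: "\<bar>f y - (a * (i \<bullet> D) + w \<bullet> D)\<bar> \<le> e * norm (y - x)"
      using d(2)[OF y] f(2) by (simp add: yx inner_add_left)
    also have "\<dots> \<le> e * (\<bar>a\<bar> + norm w)" using n e by simp
    finally have in2: "\<bar>f y - (a * (i \<bullet> D) + w \<bullet> D)\<bar> \<le> e * \<bar>a\<bar> + e * norm w" by (simp add: algebra_simps)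
    have "\<bar>w \<bullet> D\<bar> \<le> norm D * norm w" using Cauchy_Schwarz_ineq2[of w D] by (simp add: mult.commute)
    moreover have "\<bar>a * (i \<bullet> D)\<bar> = 2 * (e * \<bar>a\<bar>)" by (simp add: e_def abs_mult inner_commute)
    ultimately have "e * \<bar>a\<bar> \<le> \<bar>f y\<bar> + (norm D + e) * norm w"
      using in2 by (simp add: algebra_simps)
    also have "\<dots> \<le> (1 + norm D + e) * \<bar>f y\<bar> + (1 + norm D + e) * norm w"
      using e by (intro add_mono mult_right_mono) (auto simp: algebra_simps intro!: add_nonneg_nonneg)
    finally have "\<bar>a\<bar> \<le> K * (\<bar>f y\<bar> + norm w)"
      using e by (simp add: K_def field_simps)
    then show "\<bar>(y - x) \<bullet> i\<bar> \<le> K * (\<bar>f y\<bar> + norm ((y - x) - ((y - x) \<bullet> i) *\<^sub>R i))"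
      by (simp add: a_def w_def)
  qed fact
qed

lemma differentiable_zero_bound:
  fixes g :: "real \<Rightarrow> real"
  assumes "g differentiable (at t within I)" "g t = 0"
  shows "\<exists>K d. K > 0 \<and> d > 0 \<and> (\<forall>s\<in>I. \<bar>s - t\<bar> < d \<longrightarrow> \<bar>g s\<bar> \<le> K * \<bar>s - t\<bar>)"
proof -
  obtain v where v: "(g has_derivative (\<lambda>h. h *\<^sub>R v)) (at t within I)"
    using assms(1) by (auto simp: vector_derivative_works has_vector_derivative_def)
  then obtain d where d: "d > 0" "\<And>s. s \<in> I \<Longrightarrow> \<bar>s - t\<bar> < d \<Longrightarrow> \<bar>g s - (s - t) * v\<bar> \<le> \<bar>s - t\<bar>"
    unfolding has_derivative_within_alt using assms(2) by (auto dest!: spec[of _ "1::real"])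
  have "\<bar>g s\<bar> \<le> (1 + \<bar>v\<bar>) * \<bar>s - t\<bar>" if "s \<in> I" "\<bar>s - t\<bar> < d" for s
    using d(2)[OF that] abs_mult[of "s - t" v] by (simp add: algebra_simps)
  then show ?thesis using d(1) by (intro exI[of _ "1 + \<bar>v\<bar>"] exI[of _ d]) auto
qed

text \<open>
  On a small enough piece, replacing the \<open>i\<close>-th coordinate of \<open>x\<close> by a zero \<open>t\<close> of \<open>G(\<cdot>, x)\<close>
  is a map whose inverse is Lipschitz.
\<close>

lemma negligible_regular_zeros:
  fixes G :: "real \<Rightarrow> 'a::euclidean_space \<Rightarrow> real"
  assumes N: "negligible N" "N \<subseteq> I"
    and E: "\<And>x. x \<in> E \<Longrightarrow> \<exists>t\<in>N. \<exists>D. G t x = 0 \<and> GDERIV (G t) x :> D \<and> D \<noteq> 0 \<and>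
              (\<lambda>s. G s x) differentiable (at t within I)"
  shows "negligible E"
proof -
  \<comment> \<open>One natural number serves as constant and as inverse radius in both local
    bounds, so countably many pieces exhaust \<open>E\<close> and the bounds are uniform on
    each.\<close>
  define P where "P k i t x \<longleftrightarrow>
     (\<forall>y. norm (y - x) < inverse (real (Suc k)) \<longrightarrow>
       \<bar>(y - x) \<bullet> i\<bar> \<le> real (Suc k) * (\<bar>G t y\<bar> + norm ((y - x) - ((y - x) \<bullet> i) *\<^sub>R i))) \<and>
     (\<forall>s\<in>I. \<bar>s - t\<bar> < inverse (real (Suc k)) \<longrightarrow> \<bar>G s x\<bar> \<le> real (Suc k) * \<bar>s - t\<bar>)" for k i t x
  \<comment> \<open>Fixing the floor forces any two chosen times on a piece to differ by less than
    the radius \<open>inverse (real (Suc k))\<close>.\<close>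
  define S where "S k i j = {x. \<exists>t\<in>N. G t x = 0 \<and> P k i t x \<and> \<lfloor>real (Suc k) * t\<rfloor> = j}" for k i j
  have "E \<subseteq> (\<Union>k. \<Union>i\<in>Basis. \<Union>j. S k i j)"
  proof
    fix x assume "x \<in> E"
    then obtain t D where t: "t \<in> N" "G t x = 0" "GDERIV (G t) x :> D" "D \<noteq> 0"
      "(\<lambda>s. G s x) differentiable (at t within I)" using E by blast
    then obtain i where i: "i \<in> Basis" "D \<bullet> i \<noteq> 0"
      by (metis euclidean_all_zero_iff)
    obtain K d where K: "K > 0" "d > 0" and Kd: "\<And>y. norm (y - x) < d \<Longrightarrow>
        \<bar>(y - x) \<bullet> i\<bar> \<le> K * (\<bar>G t y\<bar> + norm ((y - x) - ((y - x) \<bullet> i) *\<^sub>R i))"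
      using GDERIV_coordinate_bound[OF t(3,2) i] by blast
    obtain K' d' where K': "K' > 0" "d' > 0" and Kd': "\<And>s. s \<in> I \<Longrightarrow> \<bar>s - t\<bar> < d' \<Longrightarrow> \<bar>G s x\<bar> \<le> K' * \<bar>s - t\<bar>"
      using differentiable_zero_bound[OF t(5,2)] by blast
    obtain k where k: "real k > K + K' + inverse d + inverse d'" using reals_Archimedean2 by blast
    moreover have "inverse d > 0" "inverse d' > 0" using K K' by auto
    ultimately have "K \<le> real (Suc k)" "K' \<le> real (Suc k)" and
        "inverse d \<le> real (Suc k)" "inverse d' \<le> real (Suc k)"
      using K K' unfolding of_nat_Suc by linarith+
    moreover from this(3,4) have "inverse (real (Suc k)) \<le> d" "inverse (real (Suc k)) \<le> d'"
      using K K' by (metis inverse_inverse_eq inverse_positive_iff_positive le_imp_inverse_le)+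
    ultimately have k': "K \<le> real (Suc k)" "K' \<le> real (Suc k)"
        "inverse (real (Suc k)) \<le> d" "inverse (real (Suc k)) \<le> d'" by blast+
    have "P k i t x" unfolding P_def
    proof (intro conjI allI impI ballI)
      fix y assume "norm (y - x) < inverse (real (Suc k))"
      then show "\<bar>(y - x) \<bullet> i\<bar> \<le> real (Suc k) * (\<bar>G t y\<bar> + norm ((y - x) - ((y - x) \<bullet> i) *\<^sub>R i))"
        using k' by (intro order_trans[OF Kd]) (auto intro!: mult_right_mono simp del: of_nat_Suc)
    next
      fix s assume "s \<in> I" "\<bar>s - t\<bar> < inverse (real (Suc k))"
      then show "\<bar>G s x\<bar> \<le> real (Suc k) * \<bar>s - t\<bar>"
        using k' by (intro order_trans[OF Kd']) (auto intro!: mult_right_mono simp del: of_nat_Suc)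
    qed
    then show "x \<in> (\<Union>k. \<Union>i\<in>Basis. \<Union>j. S k i j)"
      using t(1,2) i by (auto simp: S_def)
  qed
  moreover have "negligible (S k i j)" if i: "i \<in> Basis" for k i j
    unfolding locally_negligible_alt[of "S k i j"]
  proof
    fix x assume x: "x \<in> S k i j"
    define m where "m = real (Suc k)"
    have m: "m > 0" by (simp add: m_def)
    \<comment> \<open>Half the radius, so that any two points of \<open>U\<close> are closer than
      \<open>inverse m\<close>.\<close>
    define U where "U = S k i j \<inter> ball x (inverse m / 2)"
    have "\<exists>\<tau>. \<forall>y\<in>U. \<tau> y \<in> N \<and> G (\<tau> y) y = 0 \<and> P k i (\<tau> y) y \<and> \<lfloor>m * \<tau> y\<rfloor> = j"
      by (rule bchoice) (auto simp: U_def S_def m_def)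
    then obtain \<tau> where \<tau>: "\<And>y. y \<in> U \<Longrightarrow> \<tau> y \<in> N" "\<And>y. y \<in> U \<Longrightarrow> G (\<tau> y) y = 0"
        "\<And>y. y \<in> U \<Longrightarrow> P k i (\<tau> y) y" "\<And>y. y \<in> U \<Longrightarrow> \<lfloor>m * \<tau> y\<rfloor> = j" by blast
    define h where "h y = y + (\<tau> y - y \<bullet> i) *\<^sub>R i" for y
    define B where "B = m * (m + 2) + 2"
    \<comment> \<open>As \<open>G (\<tau> z) z = 0\<close>, the bound in time at \<open>z\<close>
      gives \<open>\<bar>G (\<tau> y) z\<bar> \<le> m * \<bar>\<tau> y - \<tau> z\<bar>\<close>; the
      bound in space at \<open>y\<close> then controls the lost coordinate. The change of
      \<open>\<tau>\<close> is at most \<open>norm (h z - h y)\<close>, and the transverse part at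
      most twice that.\<close>
    have lip: "norm (z - y) \<le> B * norm (h z - h y)" if yz: "y \<in> U" "z \<in> U" for y z
    proof -
      define a where "a = (z - y) \<bullet> i"
      define w where "w = (z - y) - a *\<^sub>R i"
      have hw: "h z - h y = w + (\<tau> z - \<tau> y) *\<^sub>R i"
        by (simp add: h_def w_def a_def algebra_simps)
      have ii: "i \<bullet> i = 1" using i by simp
      have hi: "(h z - h y) \<bullet> i = \<tau> z - \<tau> y"
        unfolding hw by (simp add: w_def a_def ii algebra_simps)
      have t1: "\<bar>\<tau> z - \<tau> y\<bar> \<le> norm (h z - h y)"
        using Basis_le_norm[OF i, of "h z - h y"] hi by simp
      have "w = (h z - h y) - (\<tau> z - \<tau> y) *\<^sub>R i" by (simp add: hw)
      then have w1: "norm w \<le> 2 * norm (h z - h y)"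
        using norm_triangle_ineq4[of "h z - h y" "(\<tau> z - \<tau> y) *\<^sub>R i"] t1 i by simp
      have "dist z y < inverse m"
        using yz dist_triangle[of z y x] by (simp add: U_def dist_commute)
      moreover have "\<bar>\<tau> y - \<tau> z\<bar> < inverse m"
      proof -
        have "\<bar>m * \<tau> y - m * \<tau> z\<bar> < 1" using \<tau>(4)[OF yz(1)] \<tau>(4)[OF yz(2)] by linarith
        then have "m * \<bar>\<tau> y - \<tau> z\<bar> < 1" using m by (simp flip: right_diff_distrib add: abs_mult)
        then show ?thesis using m by (simp add: field_simps)
      qed
      ultimately have "\<bar>a\<bar> \<le> m * (\<bar>G (\<tau> y) z\<bar> + norm w)" "\<bar>G (\<tau> y) z\<bar> \<le> m * \<bar>\<tau> y - \<tau> z\<bar>"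
        using \<tau>(3)[OF yz(1)] \<tau>(3)[OF yz(2)] \<tau>(1)[OF yz(1)] N(2)
        unfolding P_def a_def w_def m_def dist_norm by blast+
      moreover have "m * \<bar>\<tau> y - \<tau> z\<bar> \<le> m * norm (h z - h y)"
        using t1 m by (simp add: abs_minus_commute)
      ultimately have "\<bar>a\<bar> \<le> m * (\<bar>G (\<tau> y) z\<bar> + norm w)" "\<bar>G (\<tau> y) z\<bar> \<le> m * norm (h z - h y)"
        by linarith+
      moreover have "m * (\<bar>G (\<tau> y) z\<bar> + norm w) \<le> m * (m * norm (h z - h y) + 2 * norm (h z - h y))"
        using calculation(2) w1 m by (intro mult_left_mono add_mono) auto
      moreover have "norm (z - y) \<le> \<bar>a\<bar> + norm w"
        using norm_triangle_ineq[of "a *\<^sub>R i" w] i by (simp add: w_def)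
      ultimately have "norm (z - y) \<le> m * (m * norm (h z - h y) + 2 * norm (h z - h y)) + 2 * norm (h z - h y)"
        using w1 by linarith
      then show ?thesis by (simp add: B_def algebra_simps)
    qed
    have inj: "inj_on h U"
      using lip by (intro inj_onI) fastforce
    have "negligible (h ` U)"
    proof (rule negligible_subset)
      show "negligible {z. z \<bullet> i \<in> N}" by (rule negligible_coordinate_preimage) fact+
      show "h ` U \<subseteq> {z. z \<bullet> i \<in> N}" using \<tau>(1) i by (auto simp: h_def inner_add_left)
    qed
    then have "negligible (the_inv_into U h ` (h ` U))"
    proof (rule negligible_locally_Lipschitz_image[rotated])
      fix y assume "y \<in> h ` U"
      then show "\<exists>T B. open T \<and> y \<in> T \<and>
          (\<forall>z\<in>h ` U \<inter> T. norm (the_inv_into U h z - the_inv_into U h y) \<le> B * norm (z - y))"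
        using lip by (intro exI[of _ UNIV] exI[of _ B]) (auto simp: the_inv_into_f_f[OF inj])
    qed simp
    then have "negligible U"
      using inj by (simp add: image_image the_inv_into_f_f cong: image_cong)
    then show "\<exists>U. openin (top_of_set (S k i j)) U \<and> x \<in> U \<and> negligible U"
      using x m by (intro exI[of _ U]) (auto simp: U_def)
  qed
  then have "negligible (\<Union>j. S k i j)" if "i \<in> Basis" for k i
    using that by (intro negligible_countable_Union) auto
  then have "negligible (\<Union>i\<in>Basis. \<Union>j. S k i j)" for k
    by (intro negligible_countable_Union countable_finite) auto
  then have "negligible (\<Union>k. \<Union>i\<in>Basis. \<Union>j. S k i j)"
    by (intro negligible_countable_Union) auto
  ultimately show ?thesis using negligible_subset by blast
qed

subsection \<open>The intensity of a finite random set\<close>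

text \<open>\<open>card\<close> is 0 on infinite sets, so this counts points only for finite
  \<open>Z x\<close>; the results below assume finiteness.\<close>

definition zcount :: "('a \<Rightarrow> real set) \<Rightarrow> real set \<Rightarrow> 'a \<Rightarrow> ennreal" where
  "zcount Z B x = of_nat (card (Z x \<inter> B))"

lemma zcount_eq_emeasure: "finite (Z x) \<Longrightarrow> zcount Z B x = emeasure (count_space UNIV) (Z x \<inter> B)"
  by (simp add: zcount_def)

lemma zcount_mono: "finite (Z x) \<Longrightarrow> A \<subseteq> B \<Longrightarrow> zcount Z A x \<le> zcount Z B x"
  by (auto simp: zcount_def intro!: card_mono)

lemma zcount_suminf:
  assumes "finite (Z x)" "disjoint_family A"
  shows "(\<Sum>i::nat. zcount Z (A i) x) = zcount Z (\<Union>i. A i) x"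
proof -
  have "(\<Sum>i. emeasure (count_space UNIV) (Z x \<inter> A i)) = emeasure (count_space UNIV) (\<Union>i. Z x \<inter> A i)"
    using assms(2) by (intro suminf_emeasure) (auto simp: disjoint_family_on_def)
  then show ?thesis by (simp only: zcount_eq_emeasure[where Z=Z, OF assms(1)] Int_UN_distrib)
qed

text \<open>Half-lines are an intersection-stable generator of the Borel sets, so it remains to
  treat complements and disjoint unions. Complements subtract from \<open>zcount Z UNIV\<close>,
  which is handled first, as a supremum over half-lines.\<close>

lemma measurable_zcount:
  assumes fin: "\<And>x. x \<in> space M \<Longrightarrow> finite (Z x)"
    and meas: "\<And>s. zcount Z {..s} \<in> borel_measurable M"
    and B: "B \<in> sets borel"
  shows "zcount Z B \<in> borel_measurable M"
proof -
  have UN: "zcount Z UNIV \<in> borel_measurable M"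
  proof -
    have "zcount Z UNIV x = (SUP n. zcount Z {..real n} x)" if "x \<in> space M" for x
    proof (rule antisym)
      \<comment> \<open>Inserting 0 keeps \<open>Max\<close> meaningful when \<open>Z x\<close> is
        empty.\<close>
      obtain n where n: "real n > Max (insert 0 (Z x))" using reals_Archimedean2 by blast
      have "t \<le> real n" if "t \<in> Z x" for t
        using Max_ge[of "insert 0 (Z x)" t] n that fin[OF \<open>x \<in> space M\<close>] by auto
      then have "zcount Z UNIV x \<le> zcount Z {..real n} x"
        using fin[OF that] by (auto simp: zcount_def intro!: card_mono)
      then show "zcount Z UNIV x \<le> (SUP n. zcount Z {..real n} x)"
        by (rule order_trans) (rule SUP_upper, simp)
      show "(SUP n. zcount Z {..real n} x) \<le> zcount Z UNIV x"
        by (intro SUP_least zcount_mono fin that) auto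
    qed
    moreover have "(\<lambda>x. SUP n. zcount Z {..real n} x) \<in> borel_measurable M"
      using meas by (intro borel_measurable_SUP) auto
    ultimately show ?thesis by (simp cong: measurable_cong)
  qed
  have "Int_stable (range (\<lambda>s::real. {..s}))"
    by (auto simp: Int_stable_def)
  moreover have "range (\<lambda>s::real. {..s}) \<subseteq> Pow UNIV" by simp
  moreover have "B \<in> sigma_sets UNIV (range (\<lambda>s::real. {..s}))"
    using B by (simp add: borel_eq_atMost)
  ultimately show ?thesis
  proof (induction rule: sigma_sets_induct_disjoint)
    case (basic A) then show ?case using meas by auto
  next
    case empty show ?case by (simp add: zcount_def)
  next
    case (compl A)
    have "zcount Z (UNIV - A) x = zcount Z UNIV x - zcount Z A x" if "x \<in> space M" for x
    proof -
      have "Z x \<inter> (UNIV - A) = Z x - (Z x \<inter> A)" by auto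
      then have "card (Z x \<inter> (UNIV - A)) = card (Z x) - card (Z x \<inter> A)"
        using fin[OF that] by (simp add: card_Diff_subset)
      then show ?thesis by (simp add: zcount_def of_nat_diff ennreal_of_nat_eq_real_of_nat ennreal_minus card_mono[OF fin[OF that]] of_nat_diff)
    qed
    then show ?case using UN compl by (simp cong: measurable_cong)
  next
    case (union A)
    then have "(\<lambda>x. \<Sum>i. zcount Z (A i) x) \<in> borel_measurable M"
      by (intro borel_measurable_suminf_order)
    then show ?case using union fin by (simp add: zcount_suminf cong: measurable_cong)
  qed
qed

text \<open>The expected count is a measure in \<open>B\<close>, absolutely continuous by
  \<open>null\<close>, so Radon-Nikodym applies. The set \<open>E\<close> is a parameter because the
  clustered points later get a density of their own.\<close>

lemma zcount_density:
  assumes fin: "\<And>x. x \<in> space M \<Longrightarrow> finite (Z x)"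
    and meas: "\<And>s. zcount Z {..s} \<in> borel_measurable M"
    and null: "\<And>N. N \<in> null_sets lborel \<Longrightarrow> AE x in M. Z x \<inter> N = {}"
    and E: "E \<in> sets M"
  obtains f where "f \<in> borel_measurable borel"
    "\<And>B. B \<in> sets borel \<Longrightarrow> (\<integral>\<^sup>+x\<in>E. zcount Z B x \<partial>M) = (\<integral>\<^sup>+t\<in>B. f t \<partial>lborel)"
proof -
  note m = measurable_zcount[OF fin meas]
  define \<mu> where "\<mu> B = (\<integral>\<^sup>+x\<in>E. zcount Z B x \<partial>M)" for B
  define N where "N = measure_of UNIV (sets borel) \<mu>"
  have emN: "emeasure N B = \<mu> B" if "B \<in> sets borel" for B
  proof (rule emeasure_measure_of[OF N_def])
    show "positive (sets N) \<mu>" by (simp add: positive_def \<mu>_def zcount_def)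
    show "countably_additive (sets N) \<mu>"
    proof (rule countably_additiveI)
      fix A :: "nat \<Rightarrow> real set" assume A: "range A \<subseteq> sets N" "disjoint_family A"
      have [measurable]: "\<And>i. A i \<in> sets borel" using A(1) by (auto simp: N_def sets.sigma_sets_eq[of borel, simplified])
      have "(\<Sum>i. \<mu> (A i)) = (\<integral>\<^sup>+x. (\<Sum>i. zcount Z (A i) x * indicator E x) \<partial>M)"
        unfolding \<mu>_def using E m by (subst nn_integral_suminf) auto
      also have "\<dots> = \<mu> (\<Union>i. A i)"
        unfolding \<mu>_def by (intro nn_integral_cong) (simp add: zcount_suminf fin A(2))
      finally show "(\<Sum>i. \<mu> (A i)) = \<mu> (\<Union>i. A i)" .
    qed
  qed (use that in \<open>auto simp: N_def\<close>)
  have sN: "sets N = sets borel"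
    by (simp add: N_def sets.sigma_sets_eq[of borel, simplified])
  have "absolutely_continuous lborel N"
    unfolding absolutely_continuous_def
  proof
    fix B assume B: "B \<in> null_sets (lborel :: real measure)"
    have "\<mu> B = (\<integral>\<^sup>+x. 0 \<partial>M)" unfolding \<mu>_def
      by (rule nn_integral_cong_AE) (use null[OF B] in eventually_elim, simp add: zcount_def)
    with B show "B \<in> null_sets N" by (intro null_setsI) (auto simp: emN sN)
  qed
  then obtain f where f: "f \<in> borel_measurable lborel" "density lborel f = N"
    using sigma_finite_measure.Radon_Nikodym[OF sigma_finite_lborel, of N] sN by auto
  show ?thesis
  proof (rule that[of f])
    fix B assume "B \<in> sets (borel :: real measure)"
    then show "(\<integral>\<^sup>+x\<in>E. zcount Z B x \<partial>M) = (\<integral>\<^sup>+t\<in>B. f t \<partial>lborel)"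
      using emN[of B] emeasure_density[of f lborel B] f by (simp add: \<mu>_def)
  qed (use f in simp)
qed

text \<open>Lebesgue differentiation over cubes with corner \<open>t\<close>, which in dimension one
  are the intervals \<open>{t..t+h}\<close>.\<close>

lemma AE_right_derivative_integral:
  fixes f :: "real \<Rightarrow> real"
  assumes f: "integrable lborel f"
  shows "AE t in lebesgue. ((\<lambda>h. (LBINT s:{t..t+h}. f s) / h) \<longlongrightarrow> f t) (at_right 0)"
proof -
  have si: "set_integrable lborel {a..b} f" for a b
    unfolding set_integrable_def using f by (intro integrable_mult_indicator) auto
  have int: "f integrable_on cbox a b" for a b
    using set_borel_integral_eq_integral(1)[OF si] by simp
  obtain N where N: "negligible N" and lim: "\<And>t e. t \<notin> N \<Longrightarrow> 0 < e \<Longrightarrow>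
      \<exists>d>0. \<forall>h. 0 < h \<and> h < d \<longrightarrow> norm (integral (cbox t (t + h *\<^sub>R One)) f /\<^sub>R h ^ DIM(real) - f t) < e"
    using integrable_ccontinuous_explicit[of f] int by metis
  have "((\<lambda>h. (LBINT s:{t..t+h}. f s) / h) \<longlongrightarrow> f t) (at_right 0)" if "t \<notin> N" for t
  proof (rule tendstoI)
    fix e :: real assume "e > 0"
    from lim[OF that this] obtain d where d: "d > 0" "\<And>h. 0 < h \<Longrightarrow> h < d \<Longrightarrow> \<bar>integral {t..t+h} f / h - f t\<bar> < e"
      by (auto simp: divide_inverse mult.commute)
    then show "\<forall>\<^sub>F h in at_right 0. dist ((LBINT s:{t..t+h}. f s) / h) (f t) < e"
      unfolding eventually_at_right_field
      by (intro exI[of _ d]) (auto simp: dist_real_def set_borel_integral_eq_integral(2)[OF si])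
  qed
  then show ?thesis
    using N by (intro AE_I'[of N]) (auto simp: negligible_iff_null_sets)
qed

text \<open>Finite total intensity makes the density finite almost everywhere, so passing to reals
  changes it on a null set only.\<close>

lemma zcount_density_real:
  assumes fin: "\<And>x. x \<in> space M \<Longrightarrow> finite (Z x)"
    and meas: "\<And>s. zcount Z {..s} \<in> borel_measurable M"
    and null: "\<And>N. N \<in> null_sets lborel \<Longrightarrow> AE x in M. Z x \<inter> N = {}"
    and int: "(\<integral>\<^sup>+x. zcount Z UNIV x \<partial>M) < \<infinity>"
    and E: "E \<in> sets M"
  obtains f :: "real \<Rightarrow> real" where "integrable lborel f" "\<And>t. f t \<ge> 0"
    "\<And>B. B \<in> sets borel \<Longrightarrow> (\<integral>\<^sup>+x\<in>E. zcount Z B x \<partial>M) = ennreal (LBINT t:B. f t)"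
proof -
  obtain g where g[measurable]: "g \<in> borel_measurable borel" and
    gB: "\<And>B. B \<in> sets borel \<Longrightarrow> (\<integral>\<^sup>+x\<in>E. zcount Z B x \<partial>M) = (\<integral>\<^sup>+t\<in>B. g t \<partial>lborel)"
    using zcount_density[OF fin meas null E] by metis
  define f where "f t = enn2real (g t)" for t
  have [measurable]: "f \<in> borel_measurable borel" unfolding f_def by measurable
  have "(\<integral>\<^sup>+t. g t \<partial>lborel) = (\<integral>\<^sup>+x\<in>E. zcount Z UNIV x \<partial>M)"
    using gB[of UNIV] by simp
  also have "\<dots> \<le> (\<integral>\<^sup>+x. zcount Z UNIV x \<partial>M)"
    by (intro nn_integral_mono) (auto simp: indicator_def)
  finally have gfin: "(\<integral>\<^sup>+t. g t \<partial>lborel) \<noteq> \<infinity>" using int by auto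
  then have AE: "AE t in lborel. g t \<noteq> \<infinity>" by (intro nn_integral_noteq_infinite) auto
  then have fg: "AE t in lborel. ennreal (f t) = g t"
    by eventually_elim (simp add: f_def less_top)
  have f: "integrable lborel f"
  proof (rule integrableI_nonneg)
    have "(\<integral>\<^sup>+t. ennreal (f t) \<partial>lborel) = (\<integral>\<^sup>+t. g t \<partial>lborel)"
      using fg by (rule nn_integral_cong_AE)
    then show "(\<integral>\<^sup>+t. ennreal (f t) \<partial>lborel) < \<infinity>" using gfin by (simp add: less_top)
  qed (auto simp: f_def)
  show ?thesis
  proof (rule that[of f])
    fix B assume B[measurable]: "B \<in> sets (borel :: real measure)"
    have "(\<integral>\<^sup>+t\<in>B. g t \<partial>lborel) = (\<integral>\<^sup>+t. ennreal (indicator B t *\<^sub>R f t) \<partial>lborel)"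
      by (rule nn_integral_cong_AE) (use fg in eventually_elim, auto simp: indicator_def)
    also have "\<dots> = ennreal (LBINT t:B. f t)"
      unfolding set_lebesgue_integral_def
      by (rule nn_integral_eq_integral) (use integrable_mult_indicator[OF _ f, of B] B in \<open>auto simp: f_def\<close>)
    finally show "(\<integral>\<^sup>+x\<in>E. zcount Z B x \<partial>M) = ennreal (LBINT t:B. f t)" using gB[OF B] by simp
  qed (use f in \<open>auto simp: f_def\<close>)
qed

section \<open>Separation and clusters of points\<close>

lemma finite_gap:
  fixes Z :: "real set"
  assumes "finite Z"
  shows "\<exists>d>0. \<forall>s\<in>Z. \<forall>t\<in>Z. s \<noteq> t \<longrightarrow> d \<le> \<bar>s - t\<bar>"
proof -
  \<comment> \<open>The inserted 1 keeps \<open>Min D\<close> defined and positive when there are no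
    two distinct points.\<close>
  define D where "D = insert 1 ((\<lambda>(s, t). \<bar>s - t\<bar>) ` {(s, t). s \<in> Z \<and> t \<in> Z \<and> s \<noteq> t})"
  have "{(s, t). s \<in> Z \<and> t \<in> Z \<and> s \<noteq> t} \<subseteq> Z \<times> Z" by auto
  then have "finite D" unfolding D_def using assms
    by (intro finite.insertI finite_imageI) (meson finite_SigmaI finite_subset)
  moreover have "\<forall>d\<in>D. d > 0" by (auto simp: D_def)
  ultimately have "Min D > 0" by (subst Min_gr_iff) (auto simp: D_def)
  moreover have "Min D \<le> \<bar>s - t\<bar>" if "s \<in> Z" "t \<in> Z" "s \<noteq> t" for s t
    using \<open>finite D\<close> that by (intro Min_le) (auto simp: D_def)
  ultimately show ?thesis by blast
qed

text \<open>The grid intervals have length two meshes and overlap by one, so that every interval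
  shorter than a mesh fits into one of them. Letting \<open>j\<close> run over the integers keeps
  the union countable and the set measurable.\<close>

definition clustered :: "('a \<Rightarrow> real set) \<Rightarrow> nat \<Rightarrow> 'a set" where
  "clustered Z k = {x. \<exists>j::int. 2 \<le> zcount Z {j / real (Suc k)..(j + 2) / real (Suc k)} x}"

text \<open>Once \<open>2 / real (Suc k)\<close> is below the least gap in \<open>Z x\<close>, no
  grid interval can hold two points.\<close>

lemma not_clustered_eventually:
  assumes "finite (Z x)"
  shows "\<forall>\<^sub>F k in sequentially. x \<notin> clustered Z k"
proof -
  obtain d where d: "d > 0" "\<And>s t. s \<in> Z x \<Longrightarrow> t \<in> Z x \<Longrightarrow> s \<noteq> t \<Longrightarrow> d \<le> \<bar>s - t\<bar>"
    using finite_gap[OF assms] by metis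
  obtain k0 where k0: "real k0 > 2 / d" using reals_Archimedean2 by blast
  have "x \<notin> clustered Z k" if "k \<ge> k0" for k
  proof
    assume "x \<in> clustered Z k"
    then obtain j :: int where "2 \<le> card (Z x \<inter> {j / real (Suc k)..(j + 2) / real (Suc k)})"
      by (auto simp: clustered_def zcount_def simp del: of_nat_Suc)
    then obtain S where "S \<subseteq> Z x \<inter> {j / real (Suc k)..(j + 2) / real (Suc k)}" "card S = 2"
      by (rule obtain_subset_with_card_n)
    then obtain s t where st: "s \<in> Z x" "t \<in> Z x" "s \<noteq> t"
        "s \<in> {j / real (Suc k)..(j + 2) / real (Suc k)}" "t \<in> {j / real (Suc k)..(j + 2) / real (Suc k)}"
      by (auto simp: card_2_iff simp del: of_nat_Suc)
    then have "\<bar>s - t\<bar> \<le> (j + 2) / real (Suc k) - j / real (Suc k)"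
      unfolding atLeastAtMost_iff abs_le_iff by linarith
    also have "\<dots> = 2 / real (Suc k)" by (simp add: diff_divide_distrib add_divide_distrib)
    also have "\<dots> < d" using k0 that d(1) by (simp add: field_simps) (smt (verit) mult_left_mono of_nat_mono)
    finally show False using d(2)[OF st(1-3)] by simp
  qed
  then show ?thesis by (auto simp: eventually_sequentially)
qed

lemma not_clustered_le_one:
  assumes "x \<notin> clustered Z k" "h < 1 / real (Suc k)" "finite (Z x)"
  shows "zcount Z {t..t+h} x \<le> 1"
proof -
  define m where "m = real (Suc k)"
  have m: "m > 0" by (simp add: m_def)
  define j where "j = \<lfloor>t * m\<rfloor>"
  have "of_int j \<le> t * m" "t * m < of_int j + 1" by (auto simp: j_def)
  moreover have "h * m < 1" using assms(2) m unfolding m_def[symmetric] by (simp add: field_simps)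
  ultimately have "{t..t+h} \<subseteq> {j / m..(j + 2) / m}"
    using m by (auto simp: field_simps intro: order_trans)
  then have "zcount Z {t..t+h} x \<le> zcount Z {j / m..(j + 2) / m} x"
    using assms(3) by (intro zcount_mono)
  moreover have "\<not> 2 \<le> zcount Z {j / m..(j + 2) / m} x"
    using assms(1) unfolding clustered_def m_def by auto
  ultimately have "\<not> 2 \<le> zcount Z {t..t+h} x" by (meson order_trans)
  then show ?thesis by (auto simp: zcount_def)
qed


text \<open>For \<open>h\<close> below the mesh, the expected count in \<open>{t..t+h}\<close>
  exceeds the mass of exactly one point by at most the intensity of the clustered points. After
  division by \<open>h\<close> the latter tends to \<open>b k t\<close>, and \<open>k\<close> is
  free.\<close>

lemma zcount_single_rate:
  assumes fin: "\<And>x. x \<in> space M \<Longrightarrow> finite (Z x)"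
    and meas: "\<And>s. zcount Z {..s} \<in> borel_measurable M"
    and null: "\<And>N. N \<in> null_sets lborel \<Longrightarrow> AE x in M. Z x \<inter> N = {}"
    and int: "(\<integral>\<^sup>+x. zcount Z UNIV x \<partial>M) < \<infinity>"
  obtains f :: "real \<Rightarrow> real" where "integrable lborel f" "\<And>t. f t \<ge> 0"
    "\<And>B. B \<in> sets borel \<Longrightarrow> (\<integral>\<^sup>+x. zcount Z B x \<partial>M) = ennreal (LBINT t:B. f t)"
    "AE t in lebesgue. ((\<lambda>h. (LBINT s:{t..t+h}. f s) / h) \<longlongrightarrow> f t) (at_right 0)"
    "AE t in lebesgue. ((\<lambda>h. measure M {x \<in> space M. zcount Z {t..t+h} x = 1} / h) \<longlongrightarrow> f t) (at_right 0)"
proof -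
  note m = measurable_zcount[OF fin meas]
  have [measurable]: "zcount Z {a..b} \<in> borel_measurable M" "zcount Z UNIV \<in> borel_measurable M" for a b
    by (intro m; simp)+
  define C where "C k = clustered Z k \<inter> space M" for k
  have "C k = {x \<in> space M. \<exists>j::int. 2 \<le> zcount Z {j / real (Suc k)..(j + 2) / real (Suc k)} x}" for k
    by (auto simp: C_def clustered_def)
  then have C[measurable]: "C k \<in> sets M" for k by simp
  obtain f :: "real \<Rightarrow> real" where f: "integrable lborel f" "\<And>t. f t \<ge> 0"
      "\<And>B. B \<in> sets borel \<Longrightarrow> (\<integral>\<^sup>+x. zcount Z B x \<partial>M) = ennreal (LBINT t:B. f t)"
    by (rule zcount_density_real[OF fin meas null int sets.top])
      (auto simp: cong: nn_integral_cong)
  have "\<exists>b::real \<Rightarrow> real. integrable lborel b \<and> (\<forall>t. b t \<ge> 0) \<and>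
      (\<forall>B\<in>sets borel. (\<integral>\<^sup>+x\<in>C k. zcount Z B x \<partial>M) = ennreal (LBINT t:B. b t))" for k
    by (rule zcount_density_real[OF fin meas null int C]) blast+
  then obtain b :: "nat \<Rightarrow> real \<Rightarrow> real" where b: "\<And>k. integrable lborel (b k)" "\<And>k t. b k t \<ge> 0"
      "\<And>k B. B \<in> sets borel \<Longrightarrow> (\<integral>\<^sup>+x\<in>C k. zcount Z B x \<partial>M) = ennreal (LBINT t:B. b k t)"
    by metis
  \<comment> \<open>Dominated convergence: each point leaves \<open>C k\<close> for good, and the
    total count is an integrable bound.\<close>
  have "(\<lambda>k. \<integral>\<^sup>+x\<in>C k. zcount Z UNIV x \<partial>M) \<longlonglongrightarrow> (\<integral>\<^sup>+x. 0 \<partial>M)"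
  proof (rule nn_integral_dominated_convergence[where w="zcount Z UNIV"])
    show "AE x in M. (\<lambda>k. zcount Z UNIV x * indicator (C k) x) \<longlonglongrightarrow> 0"
    proof (rule AE_I2)
      fix x assume "x \<in> space M"
      then show "(\<lambda>k. zcount Z UNIV x * indicator (C k) x) \<longlonglongrightarrow> 0"
        using not_clustered_eventually[of Z x] fin
        by (intro tendsto_eventually) (auto simp: C_def indicator_def elim!: eventually_mono)
    qed
  qed (use int in \<open>auto simp: indicator_def\<close>)
  moreover have "(\<integral>\<^sup>+x\<in>C k. zcount Z UNIV x \<partial>M) = (\<integral>\<^sup>+t. ennreal (b k t) \<partial>lborel)" for k
    using b(1)[of k] b(2)[of k] b(3)[of UNIV k]
    by (subst nn_integral_eq_integral) (auto simp: set_lebesgue_integral_def)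
  ultimately have lim0: "(\<lambda>k. \<integral>\<^sup>+t. ennreal (b k t) \<partial>lborel) \<longlonglongrightarrow> 0" by simp
  have [measurable]: "b k \<in> borel_measurable borel" for k using b(1)[of k] by auto
  have "(\<integral>\<^sup>+t. (INF k. ennreal (b k t)) \<partial>lborel) \<le> 0"
    by (rule LIMSEQ_le_const[OF lim0]) (auto intro!: exI[of _ 0] nn_integral_mono INF_lower)
  \<comment> \<open>Integrals tending to 0 do not force \<open>b k t\<close> to tend to 0, but the
    infimum lies below every \<open>b k\<close> and so has integral 0.\<close>
  then have "AE t in lborel. (INF k. ennreal (b k t)) = 0"
    by (subst nn_integral_0_iff_AE[symmetric]) auto
  then have inf0: "AE t in lebesgue. (INF k. ennreal (b k t)) = 0" by (rule AE_completion)
  have fr: "AE t in lebesgue. ((\<lambda>h. (LBINT s:{t..t+h}. f s) / h) \<longlongrightarrow> f t) (at_right 0)"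
    by (rule AE_right_derivative_integral) (rule f)
  have br: "AE t in lebesgue. \<forall>k. ((\<lambda>h. (LBINT s:{t..t+h}. b k s) / h) \<longlongrightarrow> b k t) (at_right 0)"
    unfolding AE_all_countable by (intro allI AE_right_derivative_integral b)
  define p where "p t h = emeasure M {x \<in> space M. zcount Z {t..t+h} x = 1}" for t h
  have p_le: "p t h \<le> ennreal (LBINT s:{t..t+h}. f s)" for t h
  proof -
    have "p t h = (\<integral>\<^sup>+x. indicator {x \<in> space M. zcount Z {t..t+h} x = 1} x \<partial>M)"
      unfolding p_def by (subst nn_integral_indicator) auto
    also have "\<dots> \<le> (\<integral>\<^sup>+x. zcount Z {t..t+h} x \<partial>M)"
      by (intro nn_integral_mono) (auto simp: indicator_def)
    finally show ?thesis by (simp add: f(3))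
  qed
  have int_nonneg: "0 \<le> (LBINT s:{t..t+h}. f s)" "0 \<le> (LBINT s:{t..t+h}. b k s)" for t h k
    unfolding set_lebesgue_integral_def using f(2) b(2) by (auto intro!: integral_nonneg_AE)
  have p_ge: "ennreal (LBINT s:{t..t+h}. f s) \<le> p t h + ennreal (LBINT s:{t..t+h}. b k s)"
    if "h < 1 / real (Suc k)" for t h k
  proof -
    have "ennreal (LBINT s:{t..t+h}. f s) = (\<integral>\<^sup>+x. zcount Z {t..t+h} x \<partial>M)"
      by (simp add: f(3))
    also have "\<dots> \<le> (\<integral>\<^sup>+x. indicator {x \<in> space M. zcount Z {t..t+h} x = 1} x
        + zcount Z {t..t+h} x * indicator (C k) x \<partial>M)"
    \<comment> \<open>Off \<open>C k\<close> the count is 0 or 1 and equals the first indicator; on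
      \<open>C k\<close> the second summand is already the whole count.\<close>
    proof (rule nn_integral_mono)
      fix x assume x: "x \<in> space M"
      show "zcount Z {t..t+h} x \<le> indicator {x \<in> space M. zcount Z {t..t+h} x = 1} x
        + zcount Z {t..t+h} x * indicator (C k) x"
      proof (cases "x \<in> clustered Z k")
        case False
        with not_clustered_le_one[OF False that fin[OF x], of t]
        have "card (Z x \<inter> {t..t+h}) = 0 \<or> card (Z x \<inter> {t..t+h}) = 1"
          by (auto simp: zcount_def le_Suc_eq)
        then show ?thesis using x by (auto simp: zcount_def)
      qed (use x in \<open>auto simp: C_def\<close>)
    qed
    also have "\<dots> = p t h + ennreal (LBINT s:{t..t+h}. b k s)"
      unfolding p_def by (subst nn_integral_add) (auto simp: b(3))
    finally show ?thesis .
  qed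
  \<comment> \<open>Finiteness is needed here because \<open>measure\<close> returns 0 on sets of
    infinite measure.\<close>
  have p_fin: "p t h = ennreal (measure M {x \<in> space M. zcount Z {t..t+h} x = 1})" for t h
    unfolding p_def by (rule emeasure_eq_ennreal_measure)
      (metis p_le[unfolded p_def] ennreal_less_top leD top.not_eq_extremum)
  have "AE t in lebesgue. ((\<lambda>h. measure M {x \<in> space M. zcount Z {t..t+h} x = 1} / h) \<longlongrightarrow> f t) (at_right 0)"
    using inf0 fr br
  proof eventually_elim
    case (elim t)
    show ?case
    proof (rule tendstoI)
      fix e :: real assume e: "e > 0"
      have "(INF k. ennreal (b k t)) < ennreal (e / 3)" using elim(1) e by simp
      \<comment> \<open>One third of \<open>e\<close> is spent on the average of \<open>f\<close>,
        another on the average of \<open>b k\<close>.\<close>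
      then obtain k where k: "b k t < e / 3"
        unfolding INF_less_iff using b(2) by (auto simp: ennreal_less_iff)
      have 1: "\<forall>\<^sub>F h in at_right 0. dist ((LBINT s:{t..t+h}. f s) / h) (f t) < e / 3"
        by (rule tendstoD[OF elim(2)]) (use e in simp)
      have 2: "\<forall>\<^sub>F h in at_right 0. (LBINT s:{t..t+h}. b k s) / h < e / 3"
        by (rule order_tendstoD(2)[OF spec[OF elim(3)] k])
      have 3: "\<forall>\<^sub>F h in at_right 0. h \<in> {0<..<1 / real (Suc k)}"
        by (rule eventually_at_right_real) simp
      show "\<forall>\<^sub>F h in at_right 0. dist (measure M {x \<in> space M. zcount Z {t..t+h} x = 1} / h) (f t) < e"
        using 1 2 3
      proof eventually_elim
        case (elim h)
        define q where "q = measure M {x \<in> space M. zcount Z {t..t+h} x = 1}"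
        have "q \<le> (LBINT s:{t..t+h}. f s)"
          using p_le[of t h] int_nonneg(1)[of t h] by (simp add: p_fin q_def)
        moreover have "(LBINT s:{t..t+h}. f s) \<le> q + (LBINT s:{t..t+h}. b k s)"
          using p_ge[of h k t] int_nonneg(2)[of t h k] elim(3)
          by (simp add: p_fin q_def flip: ennreal_plus)
        ultimately have "q / h \<le> (LBINT s:{t..t+h}. f s) / h"
            "(LBINT s:{t..t+h}. f s) / h \<le> q / h + (LBINT s:{t..t+h}. b k s) / h"
          using elim(3) by (simp_all add: divide_right_mono flip: add_divide_distrib)
        then show ?case using elim(1,2) unfolding q_def[symmetric] dist_real_def by linarith
      qed
    qed
  qed
  with f fr show ?thesis by (rule that)
qed

subsection \<open>Sign changes and simple zeros\<close>

lemma no_zero_same_sign: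
  fixes g :: "real \<Rightarrow> real"
  assumes g: "continuous_on {a..b} g" and ab: "a \<le> b" and nz: "\<And>t. t \<in> {a..b} \<Longrightarrow> g t \<noteq> 0"
  shows "g a * g b > 0"
proof (rule ccontr)
  assume "\<not> g a * g b > 0"
  moreover have "g a \<noteq> 0" "g b \<noteq> 0" using nz ab by auto
  ultimately have "g a \<le> 0 \<and> 0 \<le> g b \<or> g b \<le> 0 \<and> 0 \<le> g a"
    by (auto simp: zero_less_mult_iff)
  then have "\<exists>t\<ge>a. t \<le> b \<and> g t = 0"
    using IVT'[of g a 0 b] IVT2'[of g b 0 a] g ab by blast
  then show False using nz by auto
qed

text \<open>The quotient \<open>g s / (s - t)\<close> is close to \<open>v\<close> and shares its
  sign. The factor \<open>s - t\<close> expresses the change of sign across \<open>t\<close>, and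
  still makes sense at an endpoint of \<open>I\<close>.\<close>

lemma simple_zero_sign:
  fixes g :: "real \<Rightarrow> real"
  assumes d: "(g has_real_derivative v) (at t within I)" and "v \<noteq> 0" "g t = 0"
  shows "\<exists>d>0. \<forall>s\<in>I. s \<noteq> t \<longrightarrow> \<bar>s - t\<bar> < d \<longrightarrow> 0 < g s * v * (s - t)"
proof -
  have "((\<lambda>s. g s / (s - t)) \<longlongrightarrow> v) (at t within I)"
    using d \<open>g t = 0\<close> by (simp add: has_field_derivative_iff)
  then have "\<forall>\<^sub>F s in at t within I. dist (g s / (s - t)) v < \<bar>v\<bar>"
    using \<open>v \<noteq> 0\<close> by (intro tendstoD) auto
  then obtain d where "d > 0" and *: "\<And>s. s \<in> I \<Longrightarrow> s \<noteq> t \<Longrightarrow> dist s t < d \<Longrightarrow> dist (g s / (s - t)) v < \<bar>v\<bar>"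
    unfolding eventually_at by metis
  have "0 < g s * v * (s - t)" if "s \<in> I" "s \<noteq> t" "\<bar>s - t\<bar> < d" for s
  proof -
    define w where "w = g s / (s - t)"
    have "\<bar>w - v\<bar> < \<bar>v\<bar>" using * that by (simp add: dist_real_def w_def)
    then have "0 < w * v" by (auto simp: zero_less_mult_iff abs_if split: if_splits)
    then have "0 < (w * v) * (s - t)\<^sup>2" using that(2) by simp
    also have "\<dots> = g s * v * (s - t)" using that(2) by (simp add: w_def power2_eq_square)
    finally show ?thesis .
  qed
  then show ?thesis using \<open>d > 0\<close> by blast
qed

text \<open>Induction on the number of zeros with the left endpoint free: moving it just past the
  least zero flips the sign of \<open>g\<close> there and removes exactly one zero.\<close>

lemma sign_change_iff_odd_zeros:
  fixes g :: "real \<Rightarrow> real"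
  assumes "continuous_on {a..b} g" "a \<le> b" "{a..b} \<subseteq> I" "g a \<noteq> 0" "g b \<noteq> 0"
    and "finite {t \<in> {a..b}. g t = 0}"
    and "\<And>t. t \<in> {a..b} \<Longrightarrow> g t = 0 \<Longrightarrow> \<exists>v. (g has_real_derivative v) (at t within I) \<and> v \<noteq> 0"
  shows "g a * g b < 0 \<longleftrightarrow> odd (card {t \<in> {a..b}. g t = 0})"
  using assms
proof (induction "card {t \<in> {a..b}. g t = 0}" arbitrary: a)
  case 0
  then have "{t \<in> {a..b}. g t = 0} = {}" by (metis card_0_eq)
  then have "g a * g b > 0" using 0 by (intro no_zero_same_sign[where g=g]) auto
  then show ?case using 0(1) by simp
next
  case (Suc n)
  define Z where "Z = {t \<in> {a..b}. g t = 0}"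
  have fin: "finite Z" and ne: "Z \<noteq> {}" using Suc unfolding Z_def by (metis, metis card.empty nat.distinct(1))
  define \<tau> where "\<tau> = Min Z"
  have \<tau>Z: "\<tau> \<in> Z" and \<tau>min: "\<And>t. t \<in> Z \<Longrightarrow> \<tau> \<le> t" using fin ne by (auto simp: \<tau>_def)
  have \<tau>: "a < \<tau>" "\<tau> < b" "g \<tau> = 0"
    using \<tau>Z \<open>g a \<noteq> 0\<close> \<open>g b \<noteq> 0\<close> by (auto simp: Z_def less_le)
  obtain v where v: "(g has_real_derivative v) (at \<tau> within I)" "v \<noteq> 0"
    using Suc.prems(7)[of \<tau>] \<tau> by auto
  obtain d where d: "d > 0" "\<And>s. s \<in> I \<Longrightarrow> s \<noteq> \<tau> \<Longrightarrow> \<bar>s - \<tau>\<bar> < d \<Longrightarrow> 0 < g s * v * (s - \<tau>)"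
    using simple_zero_sign[OF v \<tau>(3)] by blast
  \<comment> \<open>\<open>p\<close> and \<open>c\<close> bracket the least zero within distance
    \<open>d\<close>. The point \<open>p\<close> stays to the right of \<open>a\<close>, and
    \<open>c\<close> to the left of \<open>q\<close>, the next zero or else
    \<open>b\<close>.\<close>
  define p where "p = max ((a + \<tau>) / 2) (\<tau> - d / 2)"
  define q where "q = Min (insert b (Z - {\<tau>}))"
  have q: "\<tau> < q" "q \<le> b" "\<And>t. t \<in> Z \<Longrightarrow> t \<noteq> \<tau> \<Longrightarrow> q \<le> t"
  proof -
    show "\<tau> < q" unfolding q_def using fin \<tau>(2) \<tau>min by (subst Min_gr_iff) (auto simp: less_le)
  qed (use fin in \<open>auto simp: q_def intro!: Min_le\<close>)
  define c where "c = min ((\<tau> + q) / 2) (\<tau> + d / 2)"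
  have "a < p" "p < \<tau>" "\<tau> - d / 2 \<le> p" using \<tau> d(1) by (auto simp: p_def less_max_iff_disj)
  moreover from this have "p \<in> {a..b}" using \<tau> by simp
  ultimately have p: "a < p" "p < \<tau>" "\<bar>p - \<tau>\<bar> < d" "p \<in> I"
    using \<open>{a..b} \<subseteq> I\<close> d(1) by auto
  have "\<tau> < c" "c < q" "c \<le> \<tau> + d / 2" using q d(1) by (auto simp: c_def min_less_iff_disj)
  moreover from this have "c \<in> {a..b}" using \<tau> q by simp
  ultimately have c: "\<tau> < c" "c < q" "\<bar>c - \<tau>\<bar> < d" "c \<in> I"
    using \<open>{a..b} \<subseteq> I\<close> d(1) by auto
  have "g a * g p > 0"
  proof (rule no_zero_same_sign[where g=g])
    show "continuous_on {a..p} g" using Suc.prems(1) by (rule continuous_on_subset) (use p \<tau> in auto)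
    show "g t \<noteq> 0" if "t \<in> {a..p}" for t using \<tau>min[of t] that p \<tau> by (auto simp: Z_def)
  qed (use p in simp)
  moreover have "0 < g p * v * (p - \<tau>)" "0 < g c * v * (c - \<tau>)"
    using d(2) p c by auto
  then have "g p * g c < 0" using p c by (auto simp: zero_less_mult_iff mult_less_0_iff)
  ultimately have ac: "g a * g c < 0" by (auto simp: zero_less_mult_iff mult_less_0_iff)
  have Zc: "{t \<in> {c..b}. g t = 0} = Z - {\<tau>}"
  proof (intro equalityI subsetI)
    fix t assume "t \<in> Z - {\<tau>}"
    then show "t \<in> {t \<in> {c..b}. g t = 0}" using q(3)[of t] c by (auto simp: Z_def)
  qed (use c \<tau> in \<open>auto simp: Z_def\<close>)
  have cardZ: "card Z = Suc n" using Suc.hyps(2) by (simp add: Z_def)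
  have "g c * g b < 0 \<longleftrightarrow> odd (card {t \<in> {c..b}. g t = 0})"
  proof (rule Suc.hyps(1))
    show "n = card {t \<in> {c..b}. g t = 0}" unfolding Zc using fin \<tau>Z cardZ by simp
    show "continuous_on {c..b} g" using Suc.prems(1) by (rule continuous_on_subset) (use c \<tau> in auto)
    show "finite {t \<in> {c..b}. g t = 0}" unfolding Zc using fin by simp
    show "\<exists>v. (g has_real_derivative v) (at t within I) \<and> v \<noteq> 0" if "t \<in> {c..b}" "g t = 0" for t
      using Suc.prems(7)[of t] that c \<tau> by auto
  qed (use c q \<tau> ac Suc.prems in auto)
  moreover have "card {t \<in> {c..b}. g t = 0} = n" unfolding Zc using fin \<tau>Z cardZ by simp
  moreover have "g a * g b < 0 \<longleftrightarrow> \<not> g c * g b < 0"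
    using ac \<open>g b \<noteq> 0\<close> by (auto simp: mult_less_0_iff)
  ultimately show ?case using cardZ by (simp add: Z_def)
qed

text \<open>An endpoint zero makes the product 0, and otherwise parity decides. The right side is
  expressed by zeros and their number, which later yields measurability of the sign-change
  set.\<close>

lemma product_nonpos_iff:
  fixes g :: "real \<Rightarrow> real"
  assumes diff: "\<And>s. s \<in> I \<Longrightarrow> g differentiable (at s within I)"
    and simple: "\<And>s. s \<in> I \<Longrightarrow> g s = 0 \<Longrightarrow> vector_derivative g (at s within I) \<noteq> 0"
    and fin: "finite {s \<in> I. g s = 0}" and ab: "a \<le> b" "{a..b} \<subseteq> I"
  shows "g a * g b \<le> 0 \<longleftrightarrow> g a = 0 \<or> g b = 0 \<or> odd (card {s \<in> {a..b}. g s = 0})"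
proof (cases "g a = 0 \<or> g b = 0")
  case False
  have "continuous_on {a..b} g"
    using diff ab by (meson continuous_on_eq_continuous_within continuous_on_subset differentiable_imp_continuous_within)
  moreover have "finite {s \<in> {a..b}. g s = 0}"
    using fin by (rule rev_finite_subset) (use ab in auto)
  moreover have "\<exists>v. (g has_real_derivative v) (at s within I) \<and> v \<noteq> 0" if "s \<in> {a..b}" "g s = 0" for s
  proof -
    have "s \<in> I" using that ab by blast
    then show ?thesis using diff simple that
      by (auto simp: vector_derivative_works has_real_derivative_iff_has_vector_derivative)
  qed
  ultimately have "g a * g b < 0 \<longleftrightarrow> odd (card {s \<in> {a..b}. g s = 0})"
    using False ab by (intro sign_change_iff_odd_zeros[where I=I]) auto
  then show ?thesis using False by (auto simp: less_le)
qed auto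

subsection \<open>The density formula\<close>

text \<open>Endpoints come from a countable set so that countably many null sets suffice later. It
  contains \<open>l\<close> and \<open>u\<close> because a zero there can be isolated only from one
  side, and they may be irrational.\<close>

lemma isolating_interval:
  fixes Z :: "real set"
  assumes lu: "l < u" and Z: "finite Z" "\<tau> \<in> Z" "\<tau> \<in> {l..u}"
  obtains a b where "a \<in> \<rat> \<union> {l, u}" "b \<in> \<rat> \<union> {l, u}" "a < b" "{a..b} \<subseteq> {l..u}" "{a..b} \<inter> Z = {\<tau>}"
proof -
  obtain d where d: "d > 0" "\<And>s. s \<in> Z \<Longrightarrow> s \<noteq> \<tau> \<Longrightarrow> d \<le> \<bar>s - \<tau>\<bar>"
    using finite_gap[OF Z(1)] Z(2) by metis
  \<comment> \<open>Strictness when \<open>l < \<tau>\<close> ensures \<open>a < b\<close> in the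
    end; for \<open>\<tau> = l\<close> it comes from \<open>b\<close>.\<close>
  have "\<exists>a\<in>\<rat> \<union> {l, u}. l \<le> a \<and> a \<le> \<tau> \<and> \<tau> - d < a \<and> (l < \<tau> \<longrightarrow> a < \<tau>)"
  proof (cases "l < \<tau>")
    case True
    then have "max l (\<tau> - d) < \<tau>" using d by simp
    from Rats_dense_in_real[OF this] show ?thesis by force
  qed (use Z d in auto)
  then obtain a where a: "a \<in> \<rat> \<union> {l, u}" "l \<le> a" "a \<le> \<tau>" "\<tau> - d < a" "l < \<tau> \<longrightarrow> a < \<tau>" by blast
  have "\<exists>b\<in>\<rat> \<union> {l, u}. b \<le> u \<and> \<tau> \<le> b \<and> b < \<tau> + d \<and> (\<tau> < u \<longrightarrow> \<tau> < b)"
  proof (cases "\<tau> < u")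
    case True
    then have "\<tau> < min u (\<tau> + d)" using d by simp
    from Rats_dense_in_real[OF this] show ?thesis by force
  qed (use Z d in auto)
  then obtain b where b: "b \<in> \<rat> \<union> {l, u}" "b \<le> u" "\<tau> \<le> b" "b < \<tau> + d" "\<tau> < u \<longrightarrow> \<tau> < b" by blast
  have eq: "s = \<tau>" if "s \<in> Z" "a \<le> s" "s \<le> b" for s
    using d(2)[OF that(1)] that(2,3) a(4) b(4) by force
  have "{a..b} \<inter> Z = {\<tau>}"
  proof (intro equalityI subsetI)
    show "s \<in> {\<tau>}" if "s \<in> {a..b} \<inter> Z" for s using eq[of s] that by simp
  qed (use Z a(3) b(3) in simp)
  moreover have "a < b" using a(3,5) b(3,5) lu Z(3) by (cases "l < \<tau>") auto
  moreover have "{a..b} \<subseteq> {l..u}" using a(2) b(2) by auto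
  ultimately show ?thesis using that a(1) b(1) by blast
qed

lemma AE_null_integral:
  assumes "null_integral \<rho> S" and nn: "\<And>x. \<rho> x \<ge> 0"
  shows "AE x in lebesgue. \<rho> x > 0 \<longrightarrow> x \<notin> S"
proof -
  have "AE x in lebesgue. indicator S x *\<^sub>R \<rho> x = 0"
    using assms unfolding null_integral_def set_integrable_def set_lebesgue_integral_def
    by (subst integral_nonneg_eq_0_iff_AE[symmetric]) auto
  then show ?thesis by eventually_elim auto
qed

text \<open>Lebesgue measure is complete, so a set that agrees with a measurable one up to a null
  set is measurable. The agreement is known inside \<open>B\<close> only, hence
  \<open>A \<subseteq> B\<close>.\<close>

lemma lebesgue_set_from_AE:
  assumes B: "B \<in> sets lebesgue" and A: "A \<subseteq> B" and S: "S \<in> sets lebesgue"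
    and AE: "AE x in lebesgue. x \<in> B \<longrightarrow> (x \<in> A \<longleftrightarrow> x \<in> S)"
  shows "A \<in> sets lebesgue"
proof -
  obtain N where N: "N \<in> null_sets lebesgue" "{x. \<not> (x \<in> B \<longrightarrow> (x \<in> A \<longleftrightarrow> x \<in> S))} \<subseteq> N"
    using AE by (auto simp: eventually_ae_filter)
  then have "A \<inter> N \<in> sets lebesgue"
    by (metis inf_le2 negligible_iff_null_sets negligible_imp_sets negligible_subset)
  moreover have "A = (S \<inter> B - N) \<union> (A \<inter> N)" using N(2) A by auto
  moreover have "(S \<inter> B - N) \<union> (A \<inter> N) \<in> sets lebesgue"
    by (intro sets.Un sets.Diff sets.Int[OF S B] null_setsD2[OF N(1)]) fact
  ultimately show ?thesis by metis
qed

lemma grad_eq: "GDERIV f x :> D \<Longrightarrow> grad f x = D"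
  unfolding grad_def gderiv_def
proof (rule the_equality)
  fix E assume "(f has_derivative (\<lambda>h. h \<bullet> D)) (at x)" "(f has_derivative (\<lambda>h. h \<bullet> E)) (at x)"
  from has_derivative_unique[OF this] show "E = D"
    by (metis vector_eq_ldot)
qed

theorem corollary6:
  fixes G :: "real \<Rightarrow> real^'n \<Rightarrow> real" and \<rho> :: "real^'n \<Rightarrow> real" and l u :: real and I :: "real set"
  assumes n: "CARD('n) \<ge> 2"
    and lu: "l < u" and I: "I = {l..u}"
    and density: "\<And>x. \<rho> x \<ge> 0" "integrable lebesgue \<rho>" "(LINT x|lebesgue. \<rho> x) = 1"
    and EN_exists: "\<And>t. t \<in> I \<Longrightarrow>
      (\<lambda>x. zero_count G {l..t} x * ennreal (\<rho> x)) \<in> borel_measurable lebesgue"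
    and EN_finite: "expected_zeros G \<rho> I < \<infinity>"
    and H_defined: "\<And>t x. t \<in> I \<Longrightarrow> (\<lambda>s. G s x) differentiable (at t within I)"
    and Q2_defined: "\<And>t x. t \<in> I \<Longrightarrow> G t x = 0 \<Longrightarrow> \<exists>D. GDERIV (G t) x :> D"
    and A: "\<And>t. t \<in> {l..<u} - Psi l u G \<rho> \<Longrightarrow>
      \<exists>\<epsilon>0 \<in> {0<..u - t}. \<exists>C :: real \<Rightarrow> real \<times> real \<Rightarrow> real.
        (\<forall>\<epsilon> \<in> {0<..<\<epsilon>0}.
           derivs_exist_continuous I G {t..t+\<epsilon>}
             (zero_locus (pairH I G) ({t..t+\<epsilon>} \<times> {t..t+\<epsilon>})) \<and>
           null_integral \<rho> (zero_locus G {t}) \<and>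
           (\<forall>p \<in> {t..t+\<epsilon>} \<times> {t..t+\<epsilon>}. C \<epsilon> p \<ge> 0) \<and>
           dominates_surfK I G \<rho> {t..t+\<epsilon>} (C \<epsilon>) \<and>
           null_integral \<rho> (Xi (pairH I G) (Q1 I G) ({t..t+\<epsilon>} \<times> {t..t+\<epsilon>}))) \<and>
        (\<lambda>\<epsilon>. iterated_integral {t..t+\<epsilon>} (C \<epsilon>)) \<in> o[at_right 0](\<lambda>\<epsilon>. \<epsilon>)"
    and H1: "derivs_exist_continuous I G I (zero_locus (pairH I G) (I \<times> I))"
    and H2: "surfT I G \<rho> \<in> borel_measurable (lebesgue_on I)"
      "(\<integral>\<^sup>+t. surfT I G \<rho> t \<partial>lebesgue_on I) < \<infinity>"
    and H3: "\<And>t. t \<in> I \<Longrightarrow>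
      \<exists>\<epsilon>0 > 0. \<exists>C :: real \<Rightarrow> real \<times> real \<Rightarrow> real.
        (\<forall>\<epsilon> \<in> {0<..<\<epsilon>0}. dominates_surfK I G \<rho> ({t..t+\<epsilon>} \<inter> I) (C \<epsilon>)) \<and>
        (\<lambda>\<epsilon>. iterated_integral ({t..t+\<epsilon>} \<inter> I) (C \<epsilon>)) \<in> o[at_right 0](\<lambda>\<epsilon>. \<epsilon>)"
    and H4: "\<And>a b. a < b \<Longrightarrow> {a..b} \<subseteq> I \<Longrightarrow> null_integral \<rho> (Xi G (Q2 I G) {a..b})"
    and H5: "AE t in lebesgue_on I.
      \<exists>\<epsilon> \<in> {0<..u - t}. null_integral \<rho> (Xi (pairH I G) (Q1 I G) ({t..t+\<epsilon>} \<times> {t..t+\<epsilon>}))"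
  shows "(AE t in lebesgue_on I.
            (\<forall>\<epsilon> \<in> {0..u - t}. set_integrable lebesgue (Theta G t \<epsilon>) \<rho>) \<and>
            Theta_mass G \<rho> t differentiable (at 0 within {0..u - t})) \<and>
         set_integrable lebesgue I (zero_density u G \<rho>) \<and>
         enn2real (expected_zeros G \<rho> I) = (LINT t:I|lebesgue. zero_density u G \<rho> t)"
proof -

  \<comment> \<open>The good points and the measure with density \<open>\<rho>\<close>\<close>
  define zeros where "zeros x = {t \<in> I. G t x = 0}" for x
  define B where "B = {x. \<rho> x > 0}"
  define E where "E = {x \<in> B. finite (zeros x) \<and> (\<forall>t\<in>zeros x. Q2 I G t x \<noteq> 0)}"
  \<comment> \<open>Emptying the set off \<open>E\<close> makes it finite at every point, as the
    results on counts demand.\<close>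
  define Z where "Z x = (if x \<in> E then zeros x else {})" for x
  define M where "M = density lebesgue (\<lambda>x. ennreal (\<rho> x))"
  have [measurable]: "\<rho> \<in> borel_measurable lebesgue" using density(2) by auto
  have B[measurable]: "B \<in> sets lebesgue"
    using borel_measurable_less[of "\<lambda>_. 0" lebesgue \<rho>] by (simp add: B_def)
  have spM: "space M = UNIV" and sM: "sets M = sets lebesgue" by (simp_all add: M_def)
  have AE_M: "(AE x in M. P x) \<longleftrightarrow> (AE x in lebesgue. x \<in> B \<longrightarrow> P x)" for P
    unfolding M_def by (subst AE_density) (auto simp: B_def)

  \<comment> \<open>Almost sure finiteness and regularity of the zeros\<close>
  have AE_fin: "AE x in lebesgue. x \<in> B \<longrightarrow> finite (zeros x)"
  proof -
    have "AE x in lebesgue. zero_count G {l..u} x * ennreal (\<rho> x) \<noteq> \<infinity>"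
      using EN_finite lu unfolding expected_zeros_def I
      by (intro nn_integral_noteq_infinite EN_exists) (auto simp: I)
    then show ?thesis
    proof eventually_elim
      case (elim x)
      show ?case
      proof
        assume "x \<in> B"
        \<comment> \<open>An infinite count times a positive density would be infinite; for
          \<open>\<rho> x = 0\<close> the product would say nothing.\<close>
        then have "zero_count G {l..u} x \<noteq> \<infinity>" using elim by (auto simp: B_def ennreal_top_mult)
        then show "finite (zeros x)"
          by (auto simp: zero_count_def zeros_def I emeasure_count_space split: if_splits)
      qed
    qed
  qed
  \<comment> \<open>With countably many endpoints, the exceptional null sets of all the intervals
    unite to a single one.\<close>
  have "AE x in lebesgue. \<forall>a\<in>\<rat> \<union> {l, u}. \<forall>b\<in>\<rat> \<union> {l, u}. a < b \<longrightarrow> {a..b} \<subseteq> I \<longrightarrow> x \<in> B \<longrightarrow> x \<notin> Xi G (Q2 I G) {a..b}"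
  proof (intro AE_ball_countable[THEN iffD2] ballI)
    fix a b
    show "AE x in lebesgue. a < b \<longrightarrow> {a..b} \<subseteq> I \<longrightarrow> x \<in> B \<longrightarrow> x \<notin> Xi G (Q2 I G) {a..b}"
    proof (cases "a < b \<and> {a..b} \<subseteq> I")
      case True
      then show ?thesis using AE_null_integral[OF H4[of a b] density(1)] by (simp add: B_def)
    qed auto
  qed (simp_all add: countable_rat)
  with AE_fin have AE_E: "AE x in lebesgue. x \<in> B \<longrightarrow> x \<in> E"
  proof eventually_elim
    case (elim x)
    have "Q2 I G \<tau> x \<noteq> 0" if x: "x \<in> B" and \<tau>: "\<tau> \<in> zeros x" for \<tau>
    proof
      assume Q: "Q2 I G \<tau> x = 0"
      obtain a b where ab: "a \<in> \<rat> \<union> {l, u}" "b \<in> \<rat> \<union> {l, u}" "a < b" "{a..b} \<subseteq> I" "{a..b} \<inter> zeros x = {\<tau>}"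
        using isolating_interval[OF lu, of "zeros x" \<tau>] elim(1) x \<tau> by (auto simp: zeros_def I)
      have "zero_params G {a..b} x = {a..b} \<inter> zeros x"
        using ab(4) by (auto simp: zero_params_def zeros_def)
      moreover have "\<tau> \<in> {a..b}" using ab(5) by blast
      \<comment> \<open>Since \<open>\<tau>\<close> is the sole zero in the interval,
        \<open>Q2\<close> vanishes at all zeros there.\<close>
      ultimately have "x \<in> Xi G (Q2 I G) {a..b}"
        using ab(5) Q by (auto simp: Xi_def zero_params_def)
      then show False using elim(2) ab x by blast
    qed
    then show ?case using elim(1) by (auto simp: E_def)
  qed
  have E[measurable]: "E \<in> sets lebesgue"
    by (rule lebesgue_set_from_AE[OF B _ B]) (use AE_E in \<open>auto simp: E_def elim: eventually_mono\<close>)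
  have finZ: "finite (Z x)" for x by (auto simp: Z_def E_def)
  have ZI: "Z x \<subseteq> I" for x by (auto simp: Z_def zeros_def)

  \<comment> \<open>Measurability of the counts\<close>
  have meas: "zcount Z {..s} \<in> borel_measurable lebesgue" for s
  proof (cases "s < l")
    case True
    then have "Z x \<inter> {..s} = {}" for x using ZI[of x] by (force simp: I)
    then show ?thesis by (simp add: zcount_def[abs_def])
  next
    case False
    define r where "r = min s u"
    have r: "r \<in> I" using False lu by (auto simp: r_def I)
    \<comment> \<open>\<open>EN_exists\<close> concerns the product of count and density; on
      \<open>E\<close> the density is positive and can be divided out.\<close>
    have "zcount Z {..s} x = indicator E x * ((zero_count G {l..r} x * ennreal (\<rho> x)) / ennreal (\<rho> x))" for x
    proof (cases "x \<in> E")
      case True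
      then have \<rho>: "\<rho> x > 0" by (simp add: E_def B_def)
      have "zcount Z {..s} x = emeasure (count_space UNIV) (Z x \<inter> {..s})"
        using finZ by (rule zcount_eq_emeasure)
      also have "Z x \<inter> {..s} = {t \<in> {l..r}. G t x = 0}"
        using True by (auto simp: Z_def zeros_def I r_def)
      finally show ?thesis using True \<rho>
        by (simp add: zero_count_def ennreal_mult_divide_eq)
    qed (simp add: Z_def zcount_def)
    moreover have "(\<lambda>x. indicator E x * ((zero_count G {l..r} x * ennreal (\<rho> x)) / ennreal (\<rho> x))) \<in> borel_measurable lebesgue"
      using EN_exists[OF r] by measurable
    ultimately show ?thesis by (simp cong: measurable_cong)
  qed
  then have measM: "zcount Z {..s} \<in> borel_measurable M" for s by (simp add: M_def)
  note mL = measurable_zcount[of lebesgue Z, OF finZ meas]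

  \<comment> \<open>Absence of zeros at a null set of times\<close>
  have null: "AE x in M. Z x \<inter> N = {}" if N: "N \<in> null_sets lborel" for N
  proof -
    define S where "S = {x \<in> E. Z x \<inter> N \<noteq> {}}"
    have "negligible S"
    proof (rule negligible_regular_zeros[where G = G and I = I and N = "N \<inter> I"])
      show "negligible (N \<inter> I)"
        using N by (meson inf_le1 negligible_iff_null_sets negligible_subset null_sets_completionI)
      fix x assume "x \<in> S"
      then obtain t where t: "x \<in> E" "t \<in> zeros x" "t \<in> N" by (auto simp: S_def Z_def)
      then obtain D where D: "GDERIV (G t) x :> D" using Q2_defined by (auto simp: zeros_def)
      then have "grad (G t) x = D" by (rule grad_eq)
      \<comment> \<open>The norm of the gradient is a factor of \<open>Q2\<close>, which is nonzero
        at all zeros of a point of \<open>E\<close>.\<close>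
      then have "D \<noteq> 0" using t by (auto simp: E_def Q2_def)
      then show "\<exists>t\<in>N \<inter> I. \<exists>D. G t x = 0 \<and> GDERIV (G t) x :> D \<and> D \<noteq> 0 \<and> (\<lambda>s. G s x) differentiable at t within I"
        using t D H_defined by (auto simp: zeros_def)
    qed simp
    then have "AE x in lebesgue. x \<notin> S"
      by (intro AE_not_in) (simp add: negligible_iff_null_sets)
    then show ?thesis unfolding AE_M
      by eventually_elim (auto simp: S_def Z_def)
  qed

  \<comment> \<open>The total intensity and its density\<close>
  have EN: "(\<integral>\<^sup>+x. zcount Z J x \<partial>M) = expected_zeros G \<rho> I" if J: "J \<in> sets borel" "I \<subseteq> J" for J
  proof -
    have "(\<integral>\<^sup>+x. zcount Z J x \<partial>M) = (\<integral>\<^sup>+x. ennreal (\<rho> x) * zcount Z J x \<partial>lebesgue)"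
      unfolding M_def using mL[OF J(1)] by (intro nn_integral_density) auto
    also have "\<dots> = expected_zeros G \<rho> I"
      unfolding expected_zeros_def
    proof (rule nn_integral_cong_AE, use AE_E in eventually_elim)
      fix x assume x: "x \<in> B \<longrightarrow> x \<in> E"
      show "ennreal (\<rho> x) * zcount Z J x = zero_count G I x * ennreal (\<rho> x)"
      proof (cases "x \<in> B")
        case True
        then have "Z x \<inter> J = {t \<in> I. G t x = 0}" using x J by (auto simp: Z_def zeros_def)
        then show ?thesis
          by (simp add: zcount_eq_emeasure[of Z, OF finZ] zero_count_def mult.commute)
      next
        case False
        then have "\<rho> x = 0" using density(1)[of x] by (simp add: B_def)
        then show ?thesis by simp
      qed
    qed
    finally show ?thesis .
  qed
  obtain f :: "real \<Rightarrow> real" where f: "integrable lborel f" "\<And>t. f t \<ge> 0"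
    and fJ: "\<And>J. J \<in> sets borel \<Longrightarrow> (\<integral>\<^sup>+x. zcount Z J x \<partial>M) = ennreal (LBINT t:J. f t)"
    and lim_upper: "AE t in lebesgue. ((\<lambda>h. (LBINT s:{t..t+h}. f s) / h) \<longlongrightarrow> f t) (at_right 0)"
    and lim_lower: "AE t in lebesgue. ((\<lambda>h. measure M {x \<in> space M. zcount Z {t..t+h} x = 1} / h) \<longlongrightarrow> f t) (at_right 0)"
    by (rule zcount_single_rate[OF finZ measM null]) (use EN[of UNIV] EN_finite in auto)
  have f_int_nonneg: "0 \<le> (LBINT s:J. f s)" for J
    unfolding set_lebesgue_integral_def using f(2) by (auto intro!: integral_nonneg_AE)

  \<comment> \<open>Bounds for the mass of the sign-change set\<close>
  have \<Theta>: "set_integrable lebesgue (Theta G t h) \<rho>"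
      "measure M {x \<in> space M. zcount Z {t..t+h} x = 1} \<le> Theta_mass G \<rho> t h"
      "Theta_mass G \<rho> t h \<le> (LBINT s:{t..t+h}. f s)"
    if t: "t \<in> I" and h: "h \<ge> 0" "t + h \<in> I" for t h
  proof -
    have sub: "{t..t+h} \<subseteq> I" using t h by (auto simp: I)
    have [measurable]: "zcount Z {a..b} \<in> borel_measurable lebesgue"
        "zcount Z {a} \<in> borel_measurable lebesgue" for a b by (rule mL; simp)+
    \<comment> \<open>A version built from counts, hence measurable; it agrees with
      \<open>Theta G t h\<close> on \<open>E\<close> and is empty elsewhere.\<close>
    define \<Theta> where "\<Theta> = {x. zcount Z {t} x \<noteq> 0 \<or> zcount Z {t+h} x \<noteq> 0 \<or>
        (\<exists>k. odd k \<and> zcount Z {t..t+h} x = of_nat k)}"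
    have "Measurable.pred lebesgue (\<lambda>x. zcount Z {t} x \<noteq> 0 \<or> zcount Z {t+h} x \<noteq> 0 \<or>
        (\<exists>k. odd k \<and> zcount Z {t..t+h} x = of_nat k))" by measurable
    then have \<Theta>m[measurable]: "\<Theta> \<in> sets lebesgue" by (simp add: \<Theta>_def pred_def)
    have \<Theta>E: "\<Theta> \<subseteq> E" by (auto simp: \<Theta>_def Z_def zcount_def split: if_splits)
    have iff: "x \<in> Theta G t h \<longleftrightarrow> x \<in> \<Theta>" if x: "x \<in> E" for x
    proof -
      have "G t x * G (t + h) x \<le> 0 \<longleftrightarrow> G t x = 0 \<or> G (t + h) x = 0 \<or> odd (card {s \<in> {t..t+h}. G s x = 0})"
      proof (rule product_nonpos_iff[where I = I])
        show "vector_derivative (\<lambda>s. G s x) (at s within I) \<noteq> 0" if "s \<in> I" "G s x = 0" for s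
          using x that by (auto simp: E_def zeros_def Q2_def tderiv_def)
        show "finite {s \<in> I. G s x = 0}" using x by (simp add: E_def zeros_def)
      qed (use H_defined sub h in auto)
      moreover have "Z x \<inter> {t..t+h} = {s \<in> {t..t+h}. G s x = 0}" "Z x \<inter> {t} = {s \<in> {t}. G s x = 0}"
          "Z x \<inter> {t+h} = {s \<in> {t+h}. G s x = 0}"
        using x sub t h by (auto simp: Z_def zeros_def)
      ultimately show ?thesis
        by (auto simp: Theta_def \<Theta>_def zcount_def Collect_conv_if)
    qed
    have AE\<Theta>: "AE x in lebesgue. x \<in> B \<longrightarrow> (x \<in> Theta G t h \<longleftrightarrow> x \<in> \<Theta>)"
      using AE_E by eventually_elim (use iff in auto)
    \<comment> \<open>Where \<open>\<rho>\<close> vanishes, nothing is known about the measurability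
      of \<open>Theta G t h\<close>; the part inside \<open>B\<close> is all that the integrand
      sees.\<close>
    have BT: "Theta G t h \<inter> B \<in> sets lebesgue"
      by (rule lebesgue_set_from_AE[OF B _ \<Theta>m]) (use AE\<Theta> in auto)
    have restrict: "indicator (Theta G t h) x *\<^sub>R \<rho> x = indicator (Theta G t h \<inter> B) x *\<^sub>R \<rho> x" for x
      using density(1)[of x] by (auto simp: indicator_def B_def less_le)
    show int: "set_integrable lebesgue (Theta G t h) \<rho>"
      unfolding set_integrable_def restrict using density(2) BT by (intro integrable_mult_indicator)
    have "ennreal (Theta_mass G \<rho> t h) = (\<integral>\<^sup>+x. ennreal (indicator (Theta G t h) x *\<^sub>R \<rho> x) \<partial>lebesgue)"
      unfolding Theta_mass_def set_lebesgue_integral_def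
      using int density(1) by (intro nn_integral_eq_integral[symmetric]) (auto simp: set_integrable_def)
    also have "\<dots> = (\<integral>\<^sup>+x. ennreal (\<rho> x) * indicator \<Theta> x \<partial>lebesgue)"
    proof (rule nn_integral_cong_AE, use AE\<Theta> in eventually_elim)
      fix x assume "x \<in> B \<longrightarrow> (x \<in> Theta G t h \<longleftrightarrow> x \<in> \<Theta>)"
      then show "ennreal (indicator (Theta G t h) x *\<^sub>R \<rho> x) = ennreal (\<rho> x) * indicator \<Theta> x"
        using density(1)[of x] by (cases "x \<in> B") (auto simp: B_def indicator_def)
    qed
    also have "\<dots> = emeasure M \<Theta>"
      unfolding M_def by (rule emeasure_density[symmetric]) auto
    finally have mass: "emeasure M \<Theta> = ennreal (Theta_mass G \<rho> t h)" by simp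
    have mass_nonneg: "Theta_mass G \<rho> t h \<ge> 0"
      unfolding Theta_mass_def set_lebesgue_integral_def using density(1) by (auto intro!: integral_nonneg_AE)
    have "emeasure M {x \<in> space M. zcount Z {t..t+h} x = 1} \<le> emeasure M \<Theta>"
    proof (rule emeasure_mono)
      show "{x \<in> space M. zcount Z {t..t+h} x = 1} \<subseteq> \<Theta>"
        unfolding \<Theta>_def by (intro subsetI) (auto intro!: exI[of _ 1])
    qed (simp add: sM)
    then have "emeasure M {x \<in> space M. zcount Z {t..t+h} x = 1} \<le> ennreal (Theta_mass G \<rho> t h)"
      by (simp add: mass)
    then show "measure M {x \<in> space M. zcount Z {t..t+h} x = 1} \<le> Theta_mass G \<rho> t h"
      using mass_nonneg by (simp add: measure_def enn2real_leI)
    have "emeasure M \<Theta> = (\<integral>\<^sup>+x. indicator \<Theta> x \<partial>M)" by (simp add: sM)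
    also have "\<dots> \<le> (\<integral>\<^sup>+x. zcount Z {t..t+h} x \<partial>M)"
    \<comment> \<open>Every alternative in \<open>\<Theta>\<close> yields a zero in the closed
      interval: one at an endpoint, or an odd and hence positive number.\<close>
    proof (rule nn_integral_mono)
      fix x
      have "1 \<le> card (Z x \<inter> {t..t+h})" if "x \<in> \<Theta>"
      proof -
        have "Z x \<inter> {t..t+h} \<noteq> {}"
          using that h by (auto simp: \<Theta>_def zcount_def)
        then show ?thesis using finZ[of x] by (simp add: Suc_le_eq card_gt_0_iff)
      qed
      then show "indicator \<Theta> x \<le> zcount Z {t..t+h} x"
        by (auto simp: indicator_def zcount_def)
    qed
    finally show "Theta_mass G \<rho> t h \<le> (LBINT s:{t..t+h}. f s)"
      using f_int_nonneg by (simp add: mass fJ)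
  qed

  \<comment> \<open>The right derivative of the mass\<close>
  have deriv: "(Theta_mass G \<rho> t has_vector_derivative f t) (at 0 within {0..u - t})"
    if t: "t \<in> I" "t \<noteq> u"
      and up: "((\<lambda>h. (LBINT s:{t..t+h}. f s) / h) \<longlongrightarrow> f t) (at_right 0)"
      and lo: "((\<lambda>h. measure M {x \<in> space M. zcount Z {t..t+h} x = 1} / h) \<longlongrightarrow> f t) (at_right 0)" for t
  proof -
    have tu: "t < u" using t by (simp add: I)
    \<comment> \<open>A single time has intensity 0, so the bounds for \<open>h = 0\<close> give
      mass 0, and the difference quotient at 0 is the mass divided by \<open>h\<close>.\<close>
    have "(LBINT s:{t..t}. f s) = 0"
      unfolding set_lebesgue_integral_def
      by (rule integral_eq_zero_AE) (use AE_lborel_singleton[of t] in \<open>auto elim!: eventually_mono\<close>)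
    then have zero: "Theta_mass G \<rho> t 0 = 0"
      using order_trans[OF measure_nonneg \<Theta>(2)[of t 0]] \<Theta>(3)[of t 0] t(1) by simp
    have ev: "\<forall>\<^sub>F h in at_right 0. h \<in> {0<..<u - t}"
      using tu by (intro eventually_at_right_real) simp
    have "((\<lambda>h. Theta_mass G \<rho> t h / h) \<longlongrightarrow> f t) (at_right 0)"
    proof (rule tendsto_sandwich[OF _ _ lo up])
      show "\<forall>\<^sub>F h in at_right 0. measure M {x \<in> space M. zcount Z {t..t+h} x = 1} / h \<le> Theta_mass G \<rho> t h / h"
        using ev by eventually_elim (use t \<Theta>(2) in \<open>auto simp: I intro!: divide_right_mono\<close>)
      show "\<forall>\<^sub>F h in at_right 0. Theta_mass G \<rho> t h / h \<le> (LBINT s:{t..t+h}. f s) / h"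
        using ev by eventually_elim (use t \<Theta>(3) in \<open>auto simp: I intro!: divide_right_mono\<close>)
    qed
    then have "(Theta_mass G \<rho> t has_real_derivative f t) (at 0 within {0..u - t})"
      using tu by (simp add: has_field_derivative_iff at_within_Icc_at_right zero)
    then show ?thesis by (simp add: has_real_derivative_iff_has_vector_derivative)
  qed
  \<comment> \<open>At \<open>t = u\<close> the interval \<open>{0..u - t}\<close> is one point and
    determines no derivative, so this time is discarded.\<close>
  have "AE t in lebesgue. t \<noteq> u"
    by (rule AE_not_in[of "{u}", simplified]) (simp add: negligible_iff_null_sets[symmetric])
  then have AE_deriv: "AE t in lebesgue. t \<in> I \<longrightarrow>
      t < u \<and> (Theta_mass G \<rho> t has_vector_derivative f t) (at 0 within {0..u - t})"
    using lim_upper lim_lower by eventually_elim (use deriv in \<open>auto simp: I less_le\<close>)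
  have AE_density: "AE t in lebesgue. t \<in> I \<longrightarrow> zero_density u G \<rho> t = f t"
    using AE_deriv
  proof eventually_elim
    case (elim t)
    show ?case
    proof
      assume "t \<in> I"
      with elim have *: "t < u" "(Theta_mass G \<rho> t has_vector_derivative f t) (at 0 within {0..u - t})" by auto
      then have "at (0::real) within {0..u - t} \<noteq> bot" by (simp add: at_within_Icc_at_right)
      then show "zero_density u G \<rho> t = f t"
        unfolding zero_density_def by (rule vector_derivative_within) (rule *)
    qed
  qed

  \<comment> \<open>Integration of the zero density\<close>
  obtain N where N: "N \<in> null_sets lebesgue" "{t. \<not> (t \<in> I \<longrightarrow> zero_density u G \<rho> t = f t)} \<subseteq> N"
    using AE_density by (auto simp: eventually_ae_filter)
  have fL: "integrable lebesgue f" using f(1) by (simp add: integrable_completion)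
  have f_abs: "set_integrable lebesgue I f"
    unfolding set_integrable_def using fL by (intro integrable_mult_indicator) (auto simp: I)
  \<comment> \<open>Agreement with \<open>f\<close> off a null set carries integrability over,
    because Lebesgue measure is complete.\<close>
  have int: "set_integrable lebesgue I (zero_density u G \<rho>)"
    by (rule absolutely_integrable_spike[OF f_abs, of N]) (use N in \<open>auto simp: negligible_iff_null_sets\<close>)
  have "(LINT t:I|lebesgue. zero_density u G \<rho> t) = (LINT t:I|lebesgue. f t)"
    using int f_abs unfolding set_lebesgue_integral_def set_integrable_def
    by (intro integral_cong_AE) (use AE_density in \<open>auto elim!: eventually_mono\<close>)
  also have "\<dots> = (LBINT t:I. f t)"
    unfolding set_lebesgue_integral_def using f(1) by (intro integral_completion) (auto simp: I)
  also have "\<dots> = enn2real (expected_zeros G \<rho> I)"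
    using EN[of I] fJ[of I] f_int_nonneg[of I] by (simp add: I)
  finally have "enn2real (expected_zeros G \<rho> I) = (LINT t:I|lebesgue. zero_density u G \<rho> t)" ..
  moreover have "AE t in lebesgue_on I.
      (\<forall>\<epsilon> \<in> {0..u - t}. set_integrable lebesgue (Theta G t \<epsilon>) \<rho>) \<and>
      Theta_mass G \<rho> t differentiable (at 0 within {0..u - t})"
  proof (subst AE_restrict_space_iff)
    show "AE t in lebesgue. t \<in> I \<longrightarrow> (\<forall>\<epsilon> \<in> {0..u - t}. set_integrable lebesgue (Theta G t \<epsilon>) \<rho>) \<and>
      Theta_mass G \<rho> t differentiable (at 0 within {0..u - t})"
      using AE_deriv
      by eventually_elim (use \<Theta>(1) in \<open>auto simp: I intro: differentiableI_vector\<close>)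
  qed (simp add: I)
  ultimately show ?thesis using int by blast
qed

end
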